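(* Let $\vec{\mu}$ be a Schmidt vector of length $n$, let $f\in[0,1]$, and let $\rho$ be a density matrix on $\mathbb{C}^n\otimes\mathbb{C}^n$. Then $\rho\in S_{\vec{\mu},f}^{+}$ if and only if $\rho$ is $(\vec{\mu},f)$-approximable.
   Context: Setting: two parties, Alice and Bob, each hold a quantum system with Hilbert space $\mathbb{C}^n$. A Schmidt vector is $\vec{\mu}=(\mu^1,\dots,\mu^n)$ with $\mu^1\ge\dots\ge\mu^n\ge 0$ and $\sum_i\mu^i=1$. For a (possibly unnormalized, nonzero) bipartite pure state $|\psi\rangle$, $\vec{\lambda}_\psi$ denotes the vector of eigenvalues, in decreasing order, of $(\mathrm{Tr}_A|\psi\rangle\langle\psi|)/\langle\psi|\psi\rangle$ (the Schmidt coefficients). Majorization: for vectors with entries in decreasing order and summing to 1, $\vec{\lambda}\succ\vec{\mu}$ means $\sum_{i=1}^k\lambda^i\ge\sum_{i=1}^k\mu^i$ for all $k=1,\dots,n$. $\mathrm{LOCC}_1^A$ is the class of operations consisting of a local measurement/superoperator by Alice given by a set of commuting Kraus operators $A_i$ ($\sum_iA_i^\dagger A_i=\mathbf{1}$), followed by one-way classical communication from Alice to Bob, and local unitary transformations by Alice and Bob which may depend on Alice's outcome; i.e. maps $\mathcal{L}(\sigma)=\sum_i(U_iA_i\otimes V_i)\,\sigma\,(U_iA_i\otimes V_i)^\dagger$ with $U_i,V_i$ unitary. $S_{\vec{\mu}}$ is the convex closure of the set of (projectors onto) normalized pure states $|\psi\rangle\in\mathbb{C}^n\otimes\mathbb{C}^n$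 with $\vec{\lambda}_\psi\succ\vec{\mu}$. $S_{\vec{\mu},f}$ is the convex closure of the set of (projectors onto) normalized pure states $|\psi\rangle$ for which there exists a pure state $|\xi\rangle\in S_{\vec{\mu}}$ with $|\langle\xi|\psi\rangle|\ge f$. (For a pure state, membership of $|\psi\rangle$ in such a set means membership of $|\psi\rangle\langle\psi|$.) Further, $$S_{\vec{\mu},f}^{+}=\{\mathcal{L}(|\psi\rangle\langle\psi|)\;|\;\mathcal{L}\in\mathrm{LOCC}_1^A,\ |\psi\rangle\in S_{\vec{\mu},f}\}.$$ A density matrix $\rho$ is $(\vec{\mu},f)$-approximable if and only if $$\sum_i|\langle\psi_i|\psi_i'\rangle|\ge f$$ for some (finite) decomposition $\rho=\sum_i|\psi_i\rangle\langle\psi_i|$ into unnormalized vectors and some set of unnormalized vectors $\{|\psi_i'\rangle\}$ such that $\mathrm{Tr}\sum_i|\psi_i'\rangle\langle\psi_i'|=1$ and, with $p_i=\langle\psi_i'|\psi_i'\rangle$, $$\sum_ip_i\,\vec{\lambda}_{\psi_i'}\succ\vec{\mu}$$ (terms with $p_i=0$ contribute zero). *)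

theory Defs
  imports
    "HOL-Analysis.Analysis"
    "HOL-Computational_Algebra.Polynomial"
    "HOL-Library.Multiset"
begin

text \<open>
  The local space is \<open>complex ^ 'n\<close>, of dimension \<open>n = CARD('n)\<close>, for Alice as well as for Bob.
  Under the tensor product basis, the joint space is \<open>complex ^ ('n \<times> 'n)\<close>, where the first
  component of an index belongs to Alice. In \<open>A $ i $ j\<close> the row index is \<open>i\<close>.
  Real vectors of length \<open>n\<close> are functions \<open>nat \<Rightarrow> real\<close> of which only the values at
  \<open>0, \<dots>, n - 1\<close> matter: the index \<open>k\<close> here is the index \<open>k + 1\<close> in the usual counting from one.
\<close>

type_synonym 'n op = "complex ^ 'n ^ 'n"
type_synonym 'n bistate = "complex ^ ('n \<times> 'n)"
type_synonym 'n biop = "complex ^ ('n \<times> 'n) ^ ('n \<times> 'n)"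

definition braket :: "complex ^ 'k \<Rightarrow> complex ^ 'k::finite \<Rightarrow> complex" where
  "braket x y = (\<Sum>i\<in>UNIV. cnj (x $ i) * y $ i)"

definition ketbra :: "complex ^ 'k \<Rightarrow> complex ^ 'k ^ 'k::finite" where
  "ketbra x = (\<chi> i j. x $ i * cnj (x $ j))"

definition dagger :: "complex ^ 'k ^ 'm \<Rightarrow> complex ^ 'm ^ 'k" where
  "dagger A = (\<chi> i j. cnj (A $ j $ i))"

definition unitary_matrix :: "complex ^ 'k ^ 'k::finite \<Rightarrow> bool" where
  "unitary_matrix U \<longleftrightarrow> dagger U ** U = mat 1 \<and> U ** dagger U = mat 1"

definition kron :: "complex ^ 'k ^ 'k \<Rightarrow> complex ^ 'l ^ 'l
    \<Rightarrow> complex ^ ('k \<times> 'l) ^ ('k::finite \<times> 'l::finite)" where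
  "kron A B = (\<chi> i j. A $ fst i $ fst j * B $ snd i $ snd j)"

definition partial_trace_A :: "'n::finite biop \<Rightarrow> 'n op" where
  "partial_trace_A \<rho> = (\<chi> k l. \<Sum>i\<in>UNIV. \<rho> $ (i, k) $ (i, l))"

definition density_matrix :: "complex ^ 'k ^ 'k::finite \<Rightarrow> bool" where
  "density_matrix \<rho> \<longleftrightarrow>
     dagger \<rho> = \<rho> \<and> (\<forall>x. 0 \<le> Re (braket x (\<rho> *v x))) \<and> trace \<rho> = 1"

definition charpoly :: "complex ^ 'k ^ 'k::finite \<Rightarrow> complex poly" where
  "charpoly A = det (\<chi> i j. (if i = j then [:0, 1:] else 0) - [:A $ i $ j:])"

text \<open>
  Eigenvalues are listed with multiplicity in decreasing order. This is used for positive
  semidefinite matrices only, where the eigenvalues are real and \<open>Re\<close> loses nothing.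
\<close>

definition eigenvalues_desc :: "complex ^ 'k ^ 'k::finite \<Rightarrow> real list" where
  "eigenvalues_desc A = rev (sorted_list_of_multiset (image_mset Re (proots (charpoly A))))"

text \<open>For \<open>\<psi> = 0\<close> the division below by zero makes all coefficients zero.\<close>

definition schmidt :: "'n::finite bistate \<Rightarrow> nat \<Rightarrow> real" where
  "schmidt \<psi> k =
     eigenvalues_desc (\<chi> i j. partial_trace_A (ketbra \<psi>) $ i $ j / braket \<psi> \<psi>) ! k"

definition schmidt_vector :: "nat \<Rightarrow> (nat \<Rightarrow> real) \<Rightarrow> bool" where
  "schmidt_vector n \<mu> \<longleftrightarrow>
     (\<forall>i j. i \<le> j \<and> j < n \<longrightarrow> \<mu> j \<le> \<mu> i) \<and> (\<forall>i<n. 0 \<le> \<mu> i) \<and> (\<Sum>i<n. \<mu> i) = 1"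

text \<open>Majorization is only used for vectors that already are decreasing with sum one.\<close>

definition majorizes :: "nat \<Rightarrow> (nat \<Rightarrow> real) \<Rightarrow> (nat \<Rightarrow> real) \<Rightarrow> bool" where
  "majorizes n l m \<longleftrightarrow> (\<forall>k\<in>{1..n}. (\<Sum>i<k. m i) \<le> (\<Sum>i<k. l i))"

definition LOCC1A :: "('n::finite biop \<Rightarrow> 'n biop) set" where
  "LOCC1A = {L. \<exists>(m::nat) (A :: nat \<Rightarrow> 'n op) U V.
     (\<forall>i<m. \<forall>j<m. A i ** A j = A j ** A i) \<and>
     (\<Sum>i<m. dagger (A i) ** A i) = mat 1 \<and>
     (\<forall>i<m. unitary_matrix (U i) \<and> unitary_matrix (V i)) \<and>
     L = (\<lambda>\<sigma>. \<Sum>i<m. kron (U i ** A i) (V i) ** \<sigma> ** dagger (kron (U i ** A i) (V i)))}"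

definition S_mu :: "(nat \<Rightarrow> real) \<Rightarrow> 'n::finite biop set" where
  "S_mu \<mu> = convex hull
     {ketbra \<psi> | \<psi> :: 'n bistate. braket \<psi> \<psi> = 1 \<and> majorizes CARD('n) (schmidt \<psi>) \<mu>}"

definition S_mu_f :: "(nat \<Rightarrow> real) \<Rightarrow> real \<Rightarrow> 'n::finite biop set" where
  "S_mu_f \<mu> f = convex hull
     {ketbra \<psi> | \<psi> :: 'n bistate. braket \<psi> \<psi> = 1 \<and>
        (\<exists>\<xi>. braket \<xi> \<xi> = 1 \<and> ketbra \<xi> \<in> S_mu \<mu> \<and> f \<le> cmod (braket \<xi> \<psi>))}"

definition S_mu_f_plus :: "(nat \<Rightarrow> real) \<Rightarrow> real \<Rightarrow> 'n::finite biop set" where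
  "S_mu_f_plus \<mu> f =
     {L (ketbra \<psi>) | L (\<psi> :: 'n bistate).
        L \<in> LOCC1A \<and> braket \<psi> \<psi> = 1 \<and> ketbra \<psi> \<in> S_mu_f \<mu> f}"

definition approximable :: "(nat \<Rightarrow> real) \<Rightarrow> real \<Rightarrow> 'n::finite biop \<Rightarrow> bool" where
  "approximable \<mu> f \<rho> \<longleftrightarrow>
     (\<exists>(m::nat) (\<psi> :: nat \<Rightarrow> 'n bistate) (\<psi>' :: nat \<Rightarrow> 'n bistate).
        \<rho> = (\<Sum>i<m. ketbra (\<psi> i)) \<and>
        trace (\<Sum>i<m. ketbra (\<psi>' i)) = 1 \<and>
        majorizes CARD('n)
          (\<lambda>k. \<Sum>i<m. Re (braket (\<psi>' i) (\<psi>' i)) * schmidt (\<psi>' i) k) \<mu> \<and>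
        f \<le> (\<Sum>i<m. cmod (braket (\<psi> i) (\<psi>' i))))"

end

theory Submission
  imports Defs
begin

text \<open>
  By the singular value decomposition every bipartite state is \<open>U \<otimes> V\<close> applied to a state
  \<open>\<Sum>\<^sub>k d\<^sub>k |k k\<rangle>\<close> with \<open>d\<close> nonnegative and decreasing.

  Let \<open>\<xi>\<close> be a state close to \<open>\<psi>\<close> that witnesses \<open>|\<psi>\<rangle> \<in> S\<^sub>\<mu>\<^sub>,\<^sub>f\<close>. Applying the Kraus operators
  of the protocol to both states produces the decompositions wanted for approximability: their
  overlaps add up to \<open>\<langle>\<psi>, \<xi>\<rangle>\<close>, and the sum of the \<open>k\<close> largest eigenvalues of a Hermitian matrix is
  convex (Ky Fan), so Bob's average Schmidt vector majorizes that of \<open>\<xi>\<close>.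

  Conversely, if \<open>\<psi>\<^sub>i\<close> and \<open>\<psi>'\<^sub>i\<close> have singular values \<open>a\<^sub>i\<close> and \<open>b\<^sub>i\<close>, then
  \<open>|\<langle>\<psi>\<^sub>i, \<psi>'\<^sub>i\<rangle>| \<le> \<Sum>\<^sub>k a\<^sub>i\<^sub>k b\<^sub>i\<^sub>k\<close> (von Neumann). Put \<open>s\<^sub>k\<^sup>2 = \<Sum>\<^sub>i a\<^sub>i\<^sub>k\<^sup>2\<close> and \<open>t\<^sub>k\<^sup>2 = \<Sum>\<^sub>i b\<^sub>i\<^sub>k\<^sup>2\<close>.
  The diagonal Kraus operators with entries \<open>a\<^sub>i\<^sub>k / s\<^sub>k\<close>, followed by local unitaries, take
  \<open>\<Sum>\<^sub>k s\<^sub>k |k k\<rangle>\<close> to the mixture of the \<open>\<psi>\<^sub>i\<close>, and by Cauchy--Schwarz its overlap with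
  \<open>\<Sum>\<^sub>k t\<^sub>k |k k\<rangle>\<close>, whose Schmidt vector is the average one, is at least \<open>f\<close>.
\<close>

section \<open>Dirac notation and local operators\<close>

lemma Re_braket: "Re (braket x y) = x \<bullet> y"
  by (simp add: braket_def inner_vec_def inner_complex_def)

lemma cnj_braket: "cnj (braket x y) = braket y x"
  by (simp add: braket_def mult.commute)

lemma braket_self: "braket x x = of_real ((norm x)\<^sup>2)"
proof (rule complex_eqI)
  show "Re (braket x x) = Re (of_real ((norm x)\<^sup>2))"
    by (simp only: Re_braket power2_norm_eq_inner Re_complex_of_real)
  have "cnj (braket x x) = braket x x" by (rule cnj_braket)
  then show "Im (braket x x) = Im (of_real ((norm x)\<^sup>2))"
    by (simp add: complex_eq_iff)
qed

lemma braket_adjoint: "braket (K *v x) y = braket x (dagger K *v y)"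
proof -
  have "braket (K *v x) y = (\<Sum>i\<in>UNIV. \<Sum>j\<in>UNIV. cnj (K $ i $ j) * cnj (x $ j) * y $ i)"
    by (simp add: braket_def matrix_vector_mult_def sum_distrib_right)
  also have "\<dots> = (\<Sum>j\<in>UNIV. \<Sum>i\<in>UNIV. cnj (K $ i $ j) * cnj (x $ j) * y $ i)"
    by (rule sum.swap)
  also have "\<dots> = braket x (dagger K *v y)"
    by (simp add: braket_def matrix_vector_mult_def dagger_def sum_distrib_left mult_ac)
  finally show ?thesis .
qed

lemma dagger_dagger [simp]: "dagger (dagger A) = A"
  by (simp add: dagger_def vec_eq_iff)

lemma dagger_mult: "dagger (A ** B) = dagger B ** dagger A"
  by (simp add: dagger_def matrix_matrix_mult_def vec_eq_iff mult.commute)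

lemma unitary_dagger: "unitary_matrix U \<Longrightarrow> unitary_matrix (dagger U)"
  by (simp add: unitary_matrix_def)

lemma unitary_mult:
  assumes "unitary_matrix U" "unitary_matrix V" shows "unitary_matrix (U ** V)"
proof -
  have "dagger V ** dagger U ** (U ** V) = dagger V ** (dagger U ** U) ** V"
    "U ** V ** (dagger V ** dagger U) = U ** (V ** dagger V) ** dagger U"
    by (simp_all only: matrix_mul_assoc)
  with assms show ?thesis by (simp add: unitary_matrix_def dagger_mult)
qed

lemma unitary_mat_1: "unitary_matrix (mat 1)"
proof -
  have "dagger (mat 1 :: complex ^ 'k ^ 'k) = mat 1"
    by (auto simp: dagger_def mat_def vec_eq_iff)
  then show ?thesis by (simp add: unitary_matrix_def)
qed

lemma unitary_norm:
  assumes "unitary_matrix U" shows "norm (U *v x) = norm x"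
proof -
  have "braket (U *v x) (U *v x) = braket x x"
    using assms by (simp add: braket_adjoint matrix_vector_mul_assoc unitary_matrix_def)
  then have "(norm (U *v x))\<^sup>2 = (norm x)\<^sup>2"
    unfolding braket_self by (simp only: of_real_eq_iff)
  then show ?thesis by simp
qed

lemma unitary_row_sum:
  assumes "unitary_matrix U" shows "(\<Sum>j\<in>UNIV. (cmod (U $ i $ j))\<^sup>2) = 1"
proof -
  have "(U ** dagger U) $ i $ i = 1"
    using assms by (simp add: unitary_matrix_def mat_def)
  then have "(\<Sum>j\<in>UNIV. U $ i $ j * cnj (U $ i $ j)) = 1"
    by (simp add: matrix_matrix_mult_def dagger_def)
  then have "of_real (\<Sum>j\<in>UNIV. (cmod (U $ i $ j))\<^sup>2) = (1::complex)"
    by (simp only: of_real_sum complex_norm_square)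
  then show ?thesis by (simp only: of_real_eq_1_iff)
qed

lemma unitary_column_sum:
  assumes "unitary_matrix U" shows "(\<Sum>i\<in>UNIV. (cmod (U $ i $ j))\<^sup>2) = 1"
  using unitary_row_sum[OF unitary_dagger[OF assms], of j] by (simp add: dagger_def)

section \<open>Kronecker products, projectors and traces\<close>

lemma dagger_kron: "dagger (kron A B) = kron (dagger A) (dagger B)"
  by (simp add: dagger_def kron_def vec_eq_iff)

lemma sum_UNIV_prod: "(\<Sum>p\<in>UNIV. g p) = (\<Sum>i\<in>UNIV. \<Sum>j\<in>UNIV. g (i, j))"
  by (simp add: sum.cartesian_product flip: UNIV_Times_UNIV)

lemma kron_mult: "kron A B ** kron C D = kron (A ** C) (B ** D)"
  by (simp add: kron_def matrix_matrix_mult_def vec_eq_iff sum_UNIV_prod sum_product mult_ac)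

lemma kron_mat_1: "kron (mat 1) (mat 1) = (mat 1 :: complex ^ ('a::finite \<times> 'b::finite) ^ ('a \<times> 'b))"
  by (auto simp: kron_def mat_def vec_eq_iff)

lemma ketbra_matrix_vector: "ketbra (K *v x) = K ** ketbra x ** dagger K"
proof -
  have "(\<Sum>k\<in>UNIV. K $ i $ k * x $ k) * (\<Sum>l\<in>UNIV. cnj (K $ j $ l) * cnj (x $ l)) =
    (\<Sum>l\<in>UNIV. (\<Sum>k\<in>UNIV. K $ i $ k * (x $ k * cnj (x $ l))) * cnj (K $ j $ l))" for i j
    by (subst sum_product, subst sum.swap) (simp add: sum_distrib_left sum_distrib_right mult_ac)
  then show ?thesis
    by (simp add: ketbra_def matrix_matrix_mult_def matrix_vector_mult_def dagger_def vec_eq_iff)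
qed

lemma trace_ketbra: "trace (ketbra x) = of_real ((norm x)\<^sup>2)"
proof -
  have "trace (ketbra x) = braket x x"
    by (simp add: trace_def ketbra_def braket_def mult.commute)
  then show ?thesis by (simp only: braket_self)
qed

lemma trace_sum: "trace (\<Sum>i\<in>I. A i) = (\<Sum>i\<in>I. trace (A i))"
  by (simp add: trace_def sum.swap[of _ _ UNIV])

lemma braket_smult_right: "braket x (c *s y) = c * braket x y"
  by (simp add: braket_def sum_distrib_left mult_ac)

lemma braket_smult_left: "braket (c *s x) y = cnj c * braket x y"
  by (simp add: braket_def sum_distrib_left mult_ac)

lemma braket_diff_right: "braket x (y - z) = braket x y - braket x z"
  by (simp add: braket_def algebra_simps sum_subtractf)

lemma braket_diff_left: "braket (x - y) z = braket x z - braket y z"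
  by (simp add: braket_def algebra_simps sum_subtractf)

section \<open>Overlaps, phases and pure states in convex hulls\<close>

text \<open>Multiplying \<open>y\<close> by a phase makes the overlap real and nonnegative without
  changing any norm. The Cauchy-Schwarz inequality of the real inner product, which is the real part
  of \<open>braket\<close>, then applies.\<close>

lemma cmod_braket_le: "cmod (braket x y) \<le> norm x * norm y"
proof (cases "braket x y = 0")
  case False
  define c where "c = braket x y"
  define z where "z = cnj (c / of_real (cmod c)) *s y"
  have c: "c * cnj c = of_real (cmod c) * of_real (cmod c)" "c \<noteq> 0"
    using complex_norm_square[of c] False by (simp_all add: power2_eq_square c_def)
  have "braket x z = cnj (c / of_real (cmod c)) * c"
    by (simp add: z_def braket_smult_right c_def)
  with c have "braket x z = of_real (cmod c)" by (simp add: field_simps)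
  then have "cmod c = x \<bullet> z" by (metis Re_braket Re_complex_of_real)
  also have "\<dots> \<le> norm x * norm z" by (rule norm_cauchy_schwarz)
  also have "norm z = norm y"
  proof -
    have "cmod (z $ i) = cmod (y $ i)" for i using c by (simp add: z_def norm_mult norm_divide)
    then show ?thesis by (simp add: norm_vec_def)
  qed
  finally show ?thesis by (simp add: c_def)
qed simp

text \<open>The squared overlap depends on \<open>y\<close> only through its projector, and linearly
  so. It can therefore serve as a functional on matrices and be transferred between vectors with
  equal projectors.\<close>

lemma cmod_braket_ketbra: "of_real ((cmod (braket x y))\<^sup>2) = braket x (ketbra y *v x)"
proof -
  have "braket x (ketbra y *v x) = braket x y * braket y x"
    by (simp add: braket_def ketbra_def matrix_vector_mult_def sum_product sum_distrib_left mult_ac)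
  then show ?thesis
    by (simp only: complex_norm_square cnj_braket)
qed

text \<open>Equality in Cauchy-Schwarz: with \<open>c\<close> the overlap, the squared norm of
  \<open>y - c *s x\<close> expands to \<open>1 - |c|^2 = 0\<close>. The vectors differ by a phase,
  which cancels in the projector.\<close>

lemma ketbra_eq_of_cmod_braket:
  assumes "norm x = 1" "norm y = 1" "cmod (braket x y) = 1"
  shows "ketbra x = ketbra y"
proof -
  define c where "c = braket x y"
  have cc: "c * cnj c = 1" using complex_norm_square[of c] assms by (simp add: c_def)
  have "braket (y - c *s x) (y - c *s x) = braket y y - c * braket y x - cnj c * c + cnj c * c * braket x x"
    by (simp add: braket_smult_right braket_smult_left braket_diff_right braket_diff_left c_def
        algebra_simps)
  also have "braket y x = cnj c" by (simp add: c_def cnj_braket)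
  finally have "braket (y - c *s x) (y - c *s x) = 0"
    using cc assms by (simp add: braket_self mult.commute)
  then have "y = c *s x" by (simp add: braket_self)
  moreover have "c * x $ i * cnj (c * x $ j) = x $ i * cnj (x $ j)" for i j
    using cc by (metis (no_types, lifting) complex_cnj_mult mult.assoc mult.left_commute mult.right_neutral)
  ultimately show ?thesis by (simp add: ketbra_def vec_eq_iff vector_scalar_mult_def)
qed

text \<open>The linear functional \<open>X \<mapsto> \<langle>\<psi>, X \<psi>\<rangle>\<close> is at most \<open>1\<close> on pure states, with equality only at \<open>|\<psi>\<rangle>\<langle>\<psi>|\<close>.\<close>
lemma pure_in_convex_hull:
  assumes "norm \<psi> = 1" and S: "\<And>X. X \<in> S \<Longrightarrow> \<exists>\<phi>. norm \<phi> = 1 \<and> X = ketbra \<phi>"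
    and "ketbra \<psi> \<in> convex hull S"
  shows "ketbra \<psi> \<in> S"
proof (rule ccontr)
  assume not: "ketbra \<psi> \<notin> S"
  define g where "g X = Re (braket \<psi> (X *v \<psi>))" for X
  have g: "g (ketbra \<phi>) = (cmod (braket \<psi> \<phi>))\<^sup>2" for \<phi>
    unfolding g_def by (metis cmod_braket_ketbra Re_complex_of_real)
  have "linear g"
  proof
    show "g (x + y) = g x + g y" for x y
      by (simp add: g_def matrix_vector_mult_add_rdistrib braket_def algebra_simps sum.distrib)
    show "g (r *\<^sub>R x) = r *\<^sub>R g x" for r x
    proof -
      have "(r *\<^sub>R x) *v \<psi> = of_real r *s (x *v \<psi>)"
        by (simp add: vec_eq_iff matrix_vector_mult_def sum_distrib_left)
          (simp add: scaleR_conv_of_real mult_ac)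
      then show ?thesis by (simp add: g_def braket_smult_right)
    qed
  qed
  have "S \<subseteq> {X. g X < 1}"
  proof
    fix X assume "X \<in> S"
    then obtain \<phi> where \<phi>: "norm \<phi> = 1" "X = ketbra \<phi>" using S by blast
    then have "cmod (braket \<psi> \<phi>) \<noteq> 1"
      using ketbra_eq_of_cmod_braket[of \<psi> \<phi>] assms not \<open>X \<in> S\<close> by auto
    moreover have "cmod (braket \<psi> \<phi>) \<le> 1" using cmod_braket_le[of \<psi> \<phi>] \<phi> assms by simp
    ultimately show "X \<in> {X. g X < 1}" by (simp add: \<phi> g abs_square_less_1)
  qed
  moreover have "convex {X. g X < 1}"
    using convex_linear_vimage[OF \<open>linear g\<close> convex_real_interval(4)[of 1]] by (simp add: vimage_def)
  ultimately have "convex hull S \<subseteq> {X. g X < 1}" by (rule hull_minimal)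
  with assms have "g (ketbra \<psi>) < 1" by auto
  then show False using assms by (simp add: g braket_self)
qed

section \<open>Contractions of a bipartite state with a local vector\<close>

text \<open>The state is treated as an antilinear map from Bob's space to Alice's, with
  \<open>contract_A\<close> as its adjoint. The singular value decomposition of this map is the
  Schmidt decomposition.\<close>

definition contract_B :: "complex ^ 'n \<Rightarrow> 'n::finite bistate \<Rightarrow> complex ^ 'n" where
  "contract_B y \<psi> = (\<chi> i. \<Sum>k\<in>UNIV. cnj (y $ k) * \<psi> $ (i, k))"

definition contract_A :: "complex ^ 'n \<Rightarrow> 'n::finite bistate \<Rightarrow> complex ^ 'n" where
  "contract_A x \<psi> = (\<chi> k. \<Sum>i\<in>UNIV. cnj (x $ i) * \<psi> $ (i, k))"

lemma braket_contract: "braket x (contract_B y \<psi>) = braket y (contract_A x \<psi>)"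
proof -
  have "braket x (contract_B y \<psi>) = (\<Sum>i\<in>UNIV. \<Sum>k\<in>UNIV. cnj (x $ i) * (cnj (y $ k) * \<psi> $ (i, k)))"
    by (simp add: braket_def contract_B_def sum_distrib_left)
  also have "\<dots> = (\<Sum>k\<in>UNIV. \<Sum>i\<in>UNIV. cnj (x $ i) * (cnj (y $ k) * \<psi> $ (i, k)))"
    by (rule sum.swap)
  also have "\<dots> = braket y (contract_A x \<psi>)"
    by (simp add: braket_def contract_A_def sum_distrib_left mult_ac)
  finally show ?thesis .
qed

text \<open>Contracting with \<open>V *v w\<close> cancels \<open>V\<close>, since
  \<open>dagger V ** V\<close> is the identity, and only the action on Alice's side survives. As
  \<open>A\<close> is arbitrary, this applies to Kraus operators as well as to unitaries.\<close>

lemma contract_B_kron: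
  assumes "unitary_matrix V"
  shows "contract_B (V *v w) (kron A V *v \<psi>) = A *v contract_B w \<psi>"
proof -
  have "(\<Sum>k\<in>UNIV. cnj ((V *v w) $ k) * V $ k $ l) = cnj (w $ l)" for l
  proof -
    have "cnj (w $ l) = cnj ((dagger V *v (V *v w)) $ l)"
      using assms by (simp add: matrix_vector_mul_assoc unitary_matrix_def)
    also have "\<dots> = (\<Sum>k\<in>UNIV. cnj ((V *v w) $ k) * V $ k $ l)"
      by (subst matrix_vector_mult_def) (simp add: dagger_def mult.commute)
    finally show ?thesis by simp
  qed
  then have *: "(\<Sum>k\<in>UNIV. V $ k $ l * cnj ((V *v w) $ k)) = cnj (w $ l)" for l
    by (simp add: mult.commute)
  have "(\<Sum>k\<in>UNIV. cnj ((V *v w) $ k) * (kron A V *v \<psi>) $ (i, k)) =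
    (\<Sum>j\<in>UNIV. A $ i $ j * (\<Sum>l\<in>UNIV. cnj (w $ l) * \<psi> $ (j, l)))" (is "?l = ?r") for i
  proof -
    have "?l = (\<Sum>k\<in>UNIV. \<Sum>j\<in>UNIV. \<Sum>l\<in>UNIV. A $ i $ j * \<psi> $ (j, l) * (V $ k $ l * cnj ((V *v w) $ k)))"
      by (subst (2) matrix_vector_mult_def)
        (simp add: kron_def sum_UNIV_prod sum_distrib_left mult_ac)
    also have "\<dots> = (\<Sum>j\<in>UNIV. \<Sum>k\<in>UNIV. \<Sum>l\<in>UNIV. A $ i $ j * \<psi> $ (j, l) * (V $ k $ l * cnj ((V *v w) $ k)))"
      by (rule sum.swap)
    also have "\<dots> = (\<Sum>j\<in>UNIV. \<Sum>l\<in>UNIV. \<Sum>k\<in>UNIV. A $ i $ j * \<psi> $ (j, l) * (V $ k $ l * cnj ((V *v w) $ k)))"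
      by (rule sum.cong[OF refl], rule sum.swap)
    also have "\<dots> = ?r"
      by (simp add: sum_distrib_left mult_ac flip: *)
    finally show ?thesis .
  qed
  then show ?thesis
    by (simp add: contract_B_def vec_eq_iff) (simp add: matrix_vector_mult_def)
qed

section \<open>Schmidt decomposition\<close>

lemma continuous_on_braket_contract_B:
  "continuous_on S (\<lambda>(x, y). Re (braket x (contract_B y \<psi>)))"
  unfolding braket_def contract_B_def case_prod_beta
  by (simp, intro continuous_intros)

text \<open>Count real dimensions: the vectors \<open>v j\<close> and \<open>\<i> *s v j\<close>
  span a real subspace of dimension at most \<open>2 * k\<close>, hence a proper one. Real
  orthogonality to both vectors of a pair is complex orthogonality to \<open>v j\<close>.\<close>

lemma ex_unit_orthogonal:
  fixes v :: "nat \<Rightarrow> complex ^ 'n::finite"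
  assumes "k < CARD('n)"
  shows "\<exists>x. norm x = 1 \<and> (\<forall>j<k. braket (v j) x = 0)"
proof -
  define B where "B = v ` {..<k} \<union> (\<lambda>j. \<i> *s v j) ` {..<k}"
  have "dim (span B) \<le> card B"
    unfolding dim_span by (rule dim_le_card) (auto simp: B_def span_superset)
  also have "card B \<le> card {..<k} + card {..<k}"
    unfolding B_def by (intro order_trans[OF card_Un_le] add_mono card_image_le) auto
  also have "\<dots> < DIM(complex ^ 'n)" using assms by simp
  finally have "span B \<noteq> UNIV" by (metis dim_UNIV less_irrefl)
  then obtain a where a: "a \<noteq> 0" "\<forall>x \<in> span B. a \<bullet> x = 0"
    using span_not_UNIV_orthogonal by blast
  have "braket (v j) a = 0" if "j < k" for j
  proof (rule complex_eqI)
    have "v j \<in> span B" "\<i> *s v j \<in> span B"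
      using that by (auto simp: B_def intro!: span_base)
    with a have "v j \<bullet> a = 0" "(\<i> *s v j) \<bullet> a = 0" by (auto simp: inner_commute)
    then show "Re (braket (v j) a) = Re 0" "Im (braket (v j) a) = Im 0"
      by (simp_all add: braket_smult_left flip: Re_braket)
  qed
  moreover have unit: "norm (of_real (1 / norm a) *s a) = 1"
  proof -
    have "of_real (1 / norm a) *s a = (1 / norm a) *\<^sub>R a"
      by (simp add: vec_eq_iff) (simp add: scaleR_conv_of_real)
    then show ?thesis using a by simp
  qed
  ultimately have "norm (of_real (1 / norm a) *s a) = 1 \<and> (\<forall>j<k. braket (v j) (of_real (1 / norm a) *s a) = 0)"
    using a unit by (simp add: braket_smult_right)
  then show ?thesis by blast
qed

definition nonneg_decreasing :: "nat \<Rightarrow> (nat \<Rightarrow> real) \<Rightarrow> bool" where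
  "nonneg_decreasing n d \<longleftrightarrow> (\<forall>j<n. 0 \<le> d j) \<and> (\<forall>i j. i \<le> j \<and> j < n \<longrightarrow> d j \<le> d i)"

text \<open>The last conjunct bounds the singular values not yet found, and so keeps the greedy choice
  of the next one in decreasing order.\<close>
definition partial_svd ::
  "nat \<Rightarrow> 'n::finite bistate \<Rightarrow> (nat \<Rightarrow> complex ^ 'n) \<Rightarrow> (nat \<Rightarrow> complex ^ 'n) \<Rightarrow> (nat \<Rightarrow> real) \<Rightarrow> bool"
  where "partial_svd k \<psi> u v d \<longleftrightarrow>
    (\<forall>i<k. \<forall>j<k. braket (u i) (u j) = of_bool (i = j)) \<and>
    (\<forall>i<k. \<forall>j<k. braket (v i) (v j) = of_bool (i = j)) \<and>
    (\<forall>j<k. contract_B (v j) \<psi> = d j *\<^sub>R u j) \<and>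
    (\<forall>j<k. contract_A (u j) \<psi> = d j *\<^sub>R v j) \<and>
    nonneg_decreasing k d \<and>
    (\<forall>x y. norm x = 1 \<and> norm y = 1 \<and> (\<forall>j<k. braket (u j) x = 0 \<and> braket (v j) y = 0) \<longrightarrow>
      (\<forall>j<k. Re (braket x (contract_B y \<psi>)) \<le> d j))"

text \<open>Greedy construction: on unit vectors orthogonal to those already found, a maximiser of
  the form exists by compactness. It supplies the next pair of singular vectors, and the maximum is
  their singular value.\<close>

lemma ex_partial_svd:
  fixes \<psi> :: "'n::finite bistate"
  assumes "k \<le> CARD('n)"
  shows "\<exists>u v d. partial_svd k \<psi> u v d"
  using assms
proof (induction k)
  case 0
  show ?case by (simp add: partial_svd_def nonneg_decreasing_def)
next
  case (Suc k)
  then obtain u v d where psvd: "partial_svd k \<psi> u v d"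
    by (meson Suc_leD)
  then have
    on: "\<And>i j. i < k \<Longrightarrow> j < k \<Longrightarrow> braket (u i) (u j) = of_bool (i = j)"
      "\<And>i j. i < k \<Longrightarrow> j < k \<Longrightarrow> braket (v i) (v j) = of_bool (i = j)" and
    cB: "\<And>j. j < k \<Longrightarrow> contract_B (v j) \<psi> = d j *\<^sub>R u j" and
    cA: "\<And>j. j < k \<Longrightarrow> contract_A (u j) \<psi> = d j *\<^sub>R v j" and
    d: "\<And>j. j < k \<Longrightarrow> 0 \<le> d j" "\<And>i j. i \<le> j \<Longrightarrow> j < k \<Longrightarrow> d j \<le> d i" and
    mx: "\<And>x y j. norm x = 1 \<Longrightarrow> norm y = 1 \<Longrightarrow> (\<forall>j<k. braket (u j) x = 0 \<and> braket (v j) y = 0) \<Longrightarrow>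
      j < k \<Longrightarrow> Re (braket x (contract_B y \<psi>)) \<le> d j"
    by (simp_all only: partial_svd_def nonneg_decreasing_def)
  define f where "f x y = Re (braket x (contract_B y \<psi>))" for x y
  define C where "C w = {x. norm x = 1 \<and> (\<forall>j<k. braket (w j) x = 0)}" for w :: "nat \<Rightarrow> complex ^ 'n"
  have compact: "compact (C w)" for w
  proof -
    have "C w = sphere 0 1 \<inter> (\<Inter>j<k. {x. braket (w j) x = 0})"
      by (auto simp: C_def)
    moreover have "closed {x. braket (w j) x = 0}" for j
      unfolding braket_def by (intro closed_Collect_eq continuous_intros)
    ultimately show ?thesis by (simp add: closed_INT compact_Int_closed)
  qed
  have ne: "C w \<noteq> {}" for w
    using ex_unit_orthogonal[of k w] Suc.prems by (auto simp: C_def)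
  have "\<exists>p \<in> C u \<times> C v. \<forall>q \<in> C u \<times> C v. (\<lambda>(x, y). f x y) q \<le> (\<lambda>(x, y). f x y) p"
    unfolding f_def using ne
    by (intro continuous_attains_sup compact_Times compact continuous_on_braket_contract_B) auto
  then obtain x y where xy: "x \<in> C u" "y \<in> C v"
    and max: "\<And>x' y'. x' \<in> C u \<Longrightarrow> y' \<in> C v \<Longrightarrow> f x' y' \<le> f x y"
    by auto
  define \<sigma> where "\<sigma> = f x y"
  have neg: "braket a (- b) = - braket a b" "braket (- a) b = - braket a b" for a b :: "complex ^ 'n"
    by (simp_all add: braket_def sum_negf)
  \<comment> \<open>Replacing \<open>x\<close> by \<open>- x\<close> flips the sign of the form, so
    the maximum is nonnegative.\<close>
  have "- x \<in> C u" using xy by (simp add: C_def neg)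
  then have "- f x y \<le> f x y" using max[of "- x" y] xy by (simp add: f_def neg)
  then have \<sigma>0: "0 \<le> \<sigma>" by (simp add: \<sigma>_def)
  have norms: "norm x = 1" "norm y = 1" using xy by (auto simp: C_def)
  have R: "braket a (r *\<^sub>R b) = r *\<^sub>R braket a b" for a b :: "complex ^ 'n" and r
    by (simp add: braket_def scaleR_sum_right)
  text \<open>At a maximiser \<open>x\<close> of \<open>x \<mapsto> \<langle>x, z\<rangle>\<close> on a unit sphere containing the direction of \<open>z\<close>,
    Cauchy--Schwarz is an equality.\<close>
  have key: "z = \<sigma> *\<^sub>R a"
    if "norm a = 1" "a \<bullet> z = \<sigma>" "\<And>j. j < k \<Longrightarrow> braket (w j) z = 0"
      "\<And>b. b \<in> C w \<Longrightarrow> b \<bullet> z \<le> \<sigma>" for a z w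
  proof -
    have nz: "norm z \<le> \<sigma>"
    proof (cases "z = 0")
      case False
      \<comment> \<open>The normalised \<open>z\<close> is itself a competitor, and it reaches the
        value \<open>norm z\<close>.\<close>
      then have "(1 / norm z) *\<^sub>R z \<in> C w" using that(3) by (simp add: C_def R)
      from that(4)[OF this] False show ?thesis
        by (simp add: power2_eq_square flip: power2_norm_eq_inner)
    qed (simp add: \<sigma>0)
    have "(norm (z - \<sigma> *\<^sub>R a))\<^sup>2 = (norm z)\<^sup>2 - 2 * \<sigma> * (a \<bullet> z) + \<sigma>\<^sup>2 * (norm a)\<^sup>2"
      unfolding power2_norm_eq_inner
      by (simp add: inner_diff inner_commute algebra_simps power2_eq_square)
    also have "\<dots> = (norm z)\<^sup>2 - \<sigma>\<^sup>2"
      using that by (simp add: power2_eq_square)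
    also have "\<dots> \<le> 0" using power_mono[OF nz norm_ge_zero, of 2] by simp
    finally show ?thesis by simp
  qed
  have Bx: "contract_B y \<psi> = \<sigma> *\<^sub>R x"
  proof (rule key[OF norms(1)])
    show "x \<bullet> contract_B y \<psi> = \<sigma>" by (simp add: \<sigma>_def f_def Re_braket)
    \<comment> \<open>By adjointness this is \<open>d j\<close> times the inner product of
      \<open>y\<close> with \<open>v j\<close>, which vanishes. So the contraction stays orthogonal
      to the earlier \<open>u j\<close>.\<close>
    show "braket (u j) (contract_B y \<psi>) = 0" if "j < k" for j
      using xy that cA[OF that] cnj_braket[of "v j" y] by (simp add: braket_contract R C_def)
    show "b \<bullet> contract_B y \<psi> \<le> \<sigma>" if "b \<in> C u" for b
      using max[OF that xy(2)] by (simp add: \<sigma>_def f_def Re_braket)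
  qed
  have Ay: "contract_A x \<psi> = \<sigma> *\<^sub>R y"
  proof (rule key[OF norms(2)])
    show "y \<bullet> contract_A x \<psi> = \<sigma>"
      unfolding \<sigma>_def f_def braket_contract by (simp add: Re_braket)
    show "braket (v j) (contract_A x \<psi>) = 0" if "j < k" for j
      using xy that cB[OF that] cnj_braket[of "u j" x] by (simp add: R C_def flip: braket_contract)
    show "b \<bullet> contract_A x \<psi> \<le> \<sigma>" if "b \<in> C v" for b
      using max[OF xy(1) that] unfolding \<sigma>_def f_def braket_contract by (simp add: Re_braket)
  qed
  have xy0: "braket (u j) x = 0" "braket (v j) y = 0" "braket x (u j) = 0" "braket y (v j) = 0"
    if "j < k" for j
    using xy that cnj_braket[of "u j" x] cnj_braket[of "v j" y] by (auto simp: C_def)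
  have \<sigma>le: "\<sigma> \<le> d j" if "j < k" for j
    using mx[OF norms _ that] xy0 by (simp add: \<sigma>_def f_def)
  let ?u = "u(k := x)" and ?v = "v(k := y)" and ?d = "d(k := \<sigma>)"
  have "braket (?u i) (?u j) = of_bool (i = j)" "braket (?v i) (?v j) = of_bool (i = j)"
    if "i < Suc k" "j < Suc k" for i j
    using that on xy0 braket_self[of x] braket_self[of y] norms by (auto simp: less_Suc_eq)
  moreover have "contract_B (?v j) \<psi> = ?d j *\<^sub>R ?u j"
    "contract_A (?u j) \<psi> = ?d j *\<^sub>R ?v j" "0 \<le> ?d j" if "j < Suc k" for j
    using that cA cB Ay Bx d \<sigma>0 by (auto simp: less_Suc_eq)
  moreover have "?d j \<le> ?d i" if "i \<le> j" "j < Suc k" for i j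
    using that d \<sigma>le by (auto simp: less_Suc_eq)
  moreover have "Re (braket x' (contract_B y' \<psi>)) \<le> ?d j"
    if "norm x' = 1 \<and> norm y' = 1 \<and> (\<forall>j<Suc k. braket (?u j) x' = 0 \<and> braket (?v j) y' = 0)"
      "j < Suc k" for x' y' j
  proof -
    \<comment> \<open>A pair orthogonal also to \<open>x\<close> and \<open>y\<close> already took
      part in the maximisation, hence is bounded by \<sigma>. The earlier bounds carry over from the
      induction hypothesis.\<close>
    have orth: "\<forall>j<k. braket (u j) x' = 0 \<and> braket (v j) y' = 0"
      using that(1) by (metis fun_upd_other less_SucI less_irrefl)
    then have "f x' y' \<le> \<sigma>" unfolding \<sigma>_def using that(1) by (intro max) (auto simp: C_def)
    then show ?thesis using mx[OF _ _ orth] that by (auto simp: less_Suc_eq f_def)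
  qed
  ultimately have "partial_svd (Suc k) \<psi> ?u ?v ?d"
    unfolding partial_svd_def nonneg_decreasing_def by (intro conjI allI impI) (simp_all only:)
  then show ?case by blast
qed

text \<open>A fixed enumeration of the coordinates. It links vectors indexed by a finite type to
  decreasing sequences indexed by natural numbers.\<close>

definition idx :: "'n::finite \<Rightarrow> nat" where
  "idx = (SOME h. bij_betw h UNIV {..<CARD('n)})"

lemma bij_betw_idx: "bij_betw (idx :: 'n::finite \<Rightarrow> nat) UNIV {..<CARD('n)}"
proof -
  have "\<exists>h :: 'n \<Rightarrow> nat. bij_betw h UNIV {..<CARD('n)}"
    using ex_bij_betw_finite_nat[of "UNIV :: 'n set"] by (simp add: lessThan_atLeast0)
  then show ?thesis unfolding idx_def by (rule someI_ex)
qed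

lemma idx_less [simp]: "idx (i :: 'n::finite) < CARD('n)"
  using bij_betw_idx[where 'n = 'n] by (auto simp: bij_betw_def)

lemma idx_eq_iff [simp]: "idx i = idx j \<longleftrightarrow> i = j"
  using bij_betw_idx by (auto simp: bij_betw_def inj_on_def)

lemma sum_idx: "(\<Sum>i\<in>(UNIV :: 'n::finite set). g (idx i)) = (\<Sum>k<CARD('n). g k)"
  by (rule sum.reindex_bij_betw[OF bij_betw_idx])

definition schmidt_state :: "(nat \<Rightarrow> real) \<Rightarrow> 'n::finite bistate" where
  "schmidt_state d = (\<chi> p. if fst p = snd p then of_real (d (idx (fst p))) else 0)"

lemma unitary_matrix_of_orthonormal:
  fixes u :: "nat \<Rightarrow> complex ^ 'n::finite"
  assumes "\<And>i j. i < CARD('n) \<Longrightarrow> j < CARD('n) \<Longrightarrow> braket (u i) (u j) = of_bool (i = j)"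
  shows "unitary_matrix (\<chi> i j. u (idx j) $ i)"
proof -
  let ?U = "(\<chi> i j. u (idx j) $ i) :: 'n op"
  have "(dagger ?U ** ?U) $ i $ j = mat 1 $ i $ j" for i j :: 'n
    using assms[OF idx_less idx_less, of i j]
    by (simp add: dagger_def matrix_matrix_mult_def mat_def braket_def)
  then have "dagger ?U ** ?U = mat 1" by (simp add: vec_eq_iff)
  then show ?thesis by (simp add: unitary_matrix_def matrix_left_right_inverse)
qed

lemma kron_schmidt_state:
  "(kron U V *v schmidt_state d) $ (i, k) = (\<Sum>j\<in>UNIV. of_real (d (idx j)) * U $ i $ j * V $ k $ j)"
proof -
  have "(kron U V *v schmidt_state d) $ (i, k) =
    (\<Sum>j\<in>UNIV. \<Sum>l\<in>UNIV. if j = l then of_real (d (idx j)) * U $ i $ j * V $ k $ l else 0)"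
    unfolding matrix_vector_mult_def kron_def schmidt_state_def vec_lambda_beta sum_UNIV_prod
    by (intro sum.cong refl) auto
  then show ?thesis by simp
qed

text \<open>After \<open>CARD('n)\<close> greedy steps the vectors \<open>v j\<close> form an
  orthonormal basis for Bob. Expanding his coordinate in it expresses \<psi> through the
  contractions with \<open>v j\<close>, which are multiples of \<open>u j\<close>.\<close>

lemma schmidt_decomposition:
  fixes \<psi> :: "'n::finite bistate"
  obtains U V d where "unitary_matrix U" "unitary_matrix V" "nonneg_decreasing CARD('n) d"
    "\<psi> = kron U V *v schmidt_state d"
proof -
  obtain u v d where "partial_svd CARD('n) \<psi> u v d"
    using ex_partial_svd[of "CARD('n)" \<psi>] by auto
  then have
    on: "\<And>i j. i < CARD('n) \<Longrightarrow> j < CARD('n) \<Longrightarrow> braket (u i) (u j) = of_bool (i = j)"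
      "\<And>i j. i < CARD('n) \<Longrightarrow> j < CARD('n) \<Longrightarrow> braket (v i) (v j) = of_bool (i = j)" and
    cB: "\<And>j. j < CARD('n) \<Longrightarrow> contract_B (v j) \<psi> = d j *\<^sub>R u j" and
    d: "nonneg_decreasing CARD('n) d"
    by (simp_all only: partial_svd_def)
  let ?U = "(\<chi> i j. u (idx j) $ i) :: 'n op" and ?V = "(\<chi> i j. v (idx j) $ i) :: 'n op"
  have U: "unitary_matrix ?U" and V: "unitary_matrix ?V"
    by (rule unitary_matrix_of_orthonormal, simp add: on)+
  have "\<psi> $ (i, k) = (\<Sum>j\<in>UNIV. of_real (d (idx j)) * ?U $ i $ j * ?V $ k $ j)" for i k
  proof -
    have "(?V ** dagger ?V) $ k $ l = of_bool (k = l)" for l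
      using V by (simp add: unitary_matrix_def mat_def)
    then have "\<psi> $ (i, k) = (\<Sum>l\<in>UNIV. (?V ** dagger ?V) $ k $ l * \<psi> $ (i, l))"
      by simp
    also have "\<dots> = (\<Sum>l\<in>UNIV. \<Sum>j\<in>UNIV. ?V $ k $ j * (cnj (v (idx j) $ l) * \<psi> $ (i, l)))"
      by (simp add: matrix_matrix_mult_def dagger_def sum_distrib_right sum_distrib_left mult_ac)
    also have "\<dots> = (\<Sum>j\<in>UNIV. \<Sum>l\<in>UNIV. ?V $ k $ j * (cnj (v (idx j) $ l) * \<psi> $ (i, l)))"
      by (rule sum.swap)
    also have "\<dots> = (\<Sum>j\<in>UNIV. ?V $ k $ j * contract_B (v (idx j)) \<psi> $ i)"
      by (simp add: contract_B_def sum_distrib_left)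
    also have "\<dots> = (\<Sum>j\<in>UNIV. of_real (d (idx j)) * ?U $ i $ j * ?V $ k $ j)"
      by (simp add: cB) (simp add: scaleR_conv_of_real mult_ac)
    finally show ?thesis .
  qed
  then have "\<psi> = kron ?U ?V *v schmidt_state d"
    by (simp add: vec_eq_iff kron_schmidt_state)
  with U V d show ?thesis by (rule that)
qed

section \<open>Schmidt coefficients\<close>

definition diag_matrix :: "('n \<Rightarrow> 'a::zero) \<Rightarrow> 'a ^ 'n ^ 'n" where
  "diag_matrix c = (\<chi> i j. if i = j then c i else 0)"

text \<open>Lifting the entries to constant polynomials makes the characteristic polynomial a
  determinant over the polynomial ring, where multiplicativity of \<open>det\<close> is
  available.\<close>

definition const_matrix :: "'a::zero ^ 'n ^ 'm \<Rightarrow> 'a poly ^ 'n ^ 'm" where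
  "const_matrix A = (\<chi> i j. [:A $ i $ j:])"

lemma sum_const_poly: "(\<Sum>i\<in>I. [:f i:]) = [:\<Sum>i\<in>I. f i:]"
  by (induction I rule: infinite_finite_induct) auto

lemma const_matrix_mult:
  "const_matrix (A ** B) = const_matrix A ** const_matrix (B :: 'a::comm_semiring_1 ^ 'n ^ 'm)"
  by (simp add: const_matrix_def matrix_matrix_mult_def vec_eq_iff sum_const_poly mult.commute)

lemma const_matrix_mat_1: "const_matrix (mat 1) = (mat 1 :: 'a::comm_semiring_1 poly ^ 'n ^ 'n)"
  by (simp add: const_matrix_def mat_def vec_eq_iff one_pCons)

lemma charpoly_altdef: "charpoly A = det (mat [:0, 1:] - const_matrix A)"
  unfolding charpoly_def by (rule arg_cong[of _ _ det]) (simp add: vec_eq_iff mat_def const_matrix_def)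

text \<open>The scalar matrix \<open>mat [:0, 1:]\<close> commutes with the lift of
  \<open>V\<close>, so conjugating the whole characteristic matrix conjugates only \<open>A\<close>.
  The determinants of \<open>V\<close> and its adjoint cancel.\<close>

lemma charpoly_unitary_conj:
  assumes "unitary_matrix V"
  shows "charpoly (V ** A ** dagger V) = charpoly A"
proof -
  let ?X = "mat [:0, 1:] :: complex poly ^ 'a ^ 'a"
  let ?V = "const_matrix V" and ?V' = "const_matrix (dagger V)"
  have V: "?V ** ?V' = mat 1"
    using assms by (simp add: unitary_matrix_def const_matrix_mat_1 flip: const_matrix_mult)
  have diff: "B ** (C - D) = B ** C - B ** D" "(C - D) ** B = C ** B - D ** B"
    for B C D :: "complex poly ^ 'a ^ 'a"
    by (simp_all add: matrix_matrix_mult_def vec_eq_iff algebra_simps sum_subtractf)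
  have comm: "?V ** ?X = ?X ** ?V"
    by (simp add: vec_eq_iff matrix_matrix_mult_def mat_def if_distrib if_distribR cong: if_cong)
  have "?V ** (?X - const_matrix A) ** ?V' = ?V ** ?X ** ?V' - const_matrix (V ** A ** dagger V)"
    by (simp add: diff const_matrix_mult)
  also have "?V ** ?X ** ?V' = ?X"
    unfolding comm by (simp add: V flip: matrix_mul_assoc)
  finally have "charpoly (V ** A ** dagger V) = det (?V ** (?X - const_matrix A) ** ?V')"
    by (simp add: charpoly_altdef)
  also have "\<dots> = det (?X - const_matrix A) * det (?V ** ?V')"
    by (simp add: det_mul mult_ac)
  finally show ?thesis by (simp add: V charpoly_altdef)
qed

lemma charpoly_diag_matrix: "charpoly (diag_matrix c) = (\<Prod>i\<in>UNIV. [:- c i, 1:])"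
  unfolding charpoly_def by (subst det_diagonal) (auto simp: diag_matrix_def)

lemma image_mset_sum_singleton: "image_mset f (\<Sum>i\<in>I. {#g i#}) = (\<Sum>i\<in>I. {#f (g i)#})"
  by (induction I rule: infinite_finite_induct) auto

lemma eigenvalues_desc_diag:
  assumes V: "unitary_matrix V" and c: "\<And>i j. i \<le> j \<Longrightarrow> j < CARD('n) \<Longrightarrow> c j \<le> c i"
  shows "eigenvalues_desc (V ** diag_matrix (\<lambda>i :: 'n::finite. of_real (c (idx i))) ** dagger V)
    = map c [0..<CARD('n)]"
proof -
  have "proots (\<Prod>i\<in>(UNIV :: 'n set). [:- complex_of_real (c (idx i)), 1:])
      = (\<Sum>i\<in>(UNIV :: 'n set). {#complex_of_real (c (idx i))#})"
    by (subst proots_prod) auto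
  then have "image_mset Re (proots (charpoly (V ** diag_matrix (\<lambda>i :: 'n. of_real (c (idx i))) ** dagger V)))
      = (\<Sum>i\<in>(UNIV :: 'n set). {#c (idx i)#})"
    unfolding charpoly_unitary_conj[OF V] charpoly_diag_matrix
    by (simp add: image_mset_sum_singleton)
  also have "\<dots> = (\<Sum>k<CARD('n). {#c k#})" by (rule sum_idx)
  \<comment> \<open>A multiset forgets the order. The reversed list is chosen because it is
    ascending, as \<open>sorted_list_of_multiset\<close> returns it; the \<open>rev\<close> in
    \<open>eigenvalues_desc\<close> undoes the reversal.\<close>
  also have "\<dots> = mset (rev (map c [0..<CARD('n)]))"
  proof -
    have "(\<Sum>k<n. {#c k#}) = mset (rev (map c [0..<n]))" for n
      by (induction n) simp_all
    then show ?thesis .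
  qed
  finally have *: "image_mset Re (proots (charpoly (V ** diag_matrix (\<lambda>i :: 'n. of_real (c (idx i))) ** dagger V)))
     = mset (rev (map c [0..<CARD('n)]))" .
  have "sorted (rev (map c [0..<CARD('n)]))"
    by (auto simp: sorted_rev_iff_nth_mono intro: c)
  then show ?thesis unfolding eigenvalues_desc_def * sorted_list_of_multiset_mset
    by (simp add: sorted_sort_id)
qed

section \<open>Bob's reduced state in Schmidt form\<close>

lemma unitary_kron:
  assumes "unitary_matrix U" "unitary_matrix V" shows "unitary_matrix (kron U V)"
  using assms by (simp add: unitary_matrix_def dagger_kron kron_mult kron_mat_1)

lemma norm_schmidt_state: "(norm (schmidt_state d :: 'n::finite bistate))\<^sup>2 = (\<Sum>k<CARD('n). (d k)\<^sup>2)"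
proof -
  have "(norm (schmidt_state d :: 'n bistate))\<^sup>2 =
    (\<Sum>i\<in>UNIV. \<Sum>j\<in>(UNIV :: 'n set). if i = j then (d (idx i))\<^sup>2 else 0)"
    unfolding norm_vec_def L2_set_def schmidt_state_def vec_lambda_beta
    by (subst real_sqrt_pow2, simp add: sum_nonneg, unfold sum_UNIV_prod, intro sum.cong refl) auto
  also have "\<dots> = (\<Sum>i\<in>(UNIV :: 'n set). (d (idx i))\<^sup>2)" by simp
  finally show ?thesis by (simp add: sum_idx[where g = "\<lambda>k. (d k)\<^sup>2"])
qed

text \<open>Tracing out Alice pairs the columns of \<open>U\<close>, and their orthonormality
  removes the cross terms.\<close>

lemma partial_trace_schmidt_form:
  fixes d :: "nat \<Rightarrow> real"
  assumes U: "unitary_matrix U"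
  shows "partial_trace_A (ketbra (kron U V *v schmidt_state d)) =
    V ** diag_matrix (\<lambda>j. of_real ((d (idx j))\<^sup>2)) ** dagger V"
proof -
  let ?d = "\<lambda>j. complex_of_real (d (idx j))"
  have "(\<Sum>i\<in>UNIV. (\<Sum>j\<in>UNIV. ?d j * U $ i $ j * V $ k $ j) *
      cnj (\<Sum>j\<in>UNIV. ?d j * U $ i $ j * V $ l $ j)) =
      (\<Sum>j\<in>UNIV. V $ k $ j * (?d j)\<^sup>2 * cnj (V $ l $ j))" (is "?l = _") for k l
  proof -
    have "?l = (\<Sum>i\<in>UNIV. \<Sum>j\<in>UNIV. \<Sum>m\<in>UNIV.
        V $ k $ j * ?d j * ?d m * cnj (V $ l $ m) * (cnj (U $ i $ m) * U $ i $ j))"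
      by (simp add: sum_product mult_ac)
    also have "\<dots> = (\<Sum>j\<in>UNIV. \<Sum>i\<in>UNIV. \<Sum>m\<in>UNIV.
        V $ k $ j * ?d j * ?d m * cnj (V $ l $ m) * (cnj (U $ i $ m) * U $ i $ j))"
      by (rule sum.swap)
    also have "\<dots> = (\<Sum>j\<in>UNIV. \<Sum>m\<in>UNIV. \<Sum>i\<in>UNIV.
        V $ k $ j * ?d j * ?d m * cnj (V $ l $ m) * (cnj (U $ i $ m) * U $ i $ j))"
      by (rule sum.cong[OF refl], rule sum.swap)
    also have "\<dots> = (\<Sum>j\<in>UNIV. \<Sum>m\<in>UNIV.
        V $ k $ j * ?d j * ?d m * cnj (V $ l $ m) * (dagger U ** U) $ m $ j)"
      by (simp add: matrix_matrix_mult_def dagger_def sum_distrib_left)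
    also have "\<dots> = (\<Sum>j\<in>UNIV. V $ k $ j * (?d j)\<^sup>2 * cnj (V $ l $ j))"
      using U by (simp add: unitary_matrix_def mat_def power2_eq_square mult_ac if_distrib cong: if_cong)
    finally show ?thesis .
  qed
  then show ?thesis
    by (simp add: partial_trace_A_def ketbra_def kron_schmidt_state vec_eq_iff
        matrix_matrix_mult_def diag_matrix_def dagger_def if_distrib if_distribR cong: if_cong)
qed

text \<open>The factor \<open>(norm \<psi>)\<^sup>2\<close> undoes the normalisation inside
  \<open>schmidt\<close>. In this form the identity also covers the zero vector and fits the
  weighted average in \<open>approximable\<close>.\<close>

lemma norm_square_mult_schmidt:
  fixes d :: "nat \<Rightarrow> real"
  assumes U: "unitary_matrix U" and V: "unitary_matrix V" and d: "nonneg_decreasing CARD('n) d"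
    and \<psi>: "\<psi> = kron U V *v (schmidt_state d :: 'n::finite bistate)" and k: "k < CARD('n)"
  shows "(norm \<psi>)\<^sup>2 * schmidt \<psi> k = (d k)\<^sup>2"
proof (cases "\<psi> = 0")
  case True
  have "(norm \<psi>)\<^sup>2 = (\<Sum>k<CARD('n). (d k)\<^sup>2)"
    using norm_schmidt_state[where 'n = 'n, of d] by (simp add: \<psi> unitary_norm unitary_kron U V)
  with True have "\<forall>k<CARD('n). (d k)\<^sup>2 = 0" by (simp add: sum_nonneg_eq_0_iff)
  then show ?thesis using True k by simp
next
  case False
  define c where "c k = (d k)\<^sup>2 / (norm \<psi>)\<^sup>2" for k
  have "(\<chi> i j. partial_trace_A (ketbra \<psi>) $ i $ j / braket \<psi> \<psi>) =
      V ** diag_matrix (\<lambda>j. of_real (c (idx j))) ** dagger V"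
    unfolding braket_self unfolding \<psi> partial_trace_schmidt_form[OF U]
    by (simp add: \<psi> c_def vec_eq_iff matrix_matrix_mult_def diag_matrix_def sum_divide_distrib
        if_distrib if_distribR cong: if_cong)
  moreover have "c j \<le> c i" if "i \<le> j" "j < CARD('n)" for i j
    using d that unfolding c_def nonneg_decreasing_def by (intro divide_right_mono power_mono) auto
  ultimately have "schmidt \<psi> k = c k"
    unfolding schmidt_def using k by (simp add: eigenvalues_desc_diag[OF V])
  then show ?thesis using False by (simp add: c_def)
qed

section \<open>Inequalities of von Neumann and Ky Fan\<close>

lemma sum_idx_less:
  assumes "k \<le> CARD('n)"
  shows "(\<Sum>i | idx (i :: 'n::finite) < k. g (idx i)) = (\<Sum>l<k. g l)"
proof -
  have "bij_betw idx {i :: 'n. idx i < k} {..<k}"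
  proof (rule bij_betw_subset[OF bij_betw_idx])
    have "l \<in> idx ` {i :: 'n. idx i < k}" if "l < k" for l
    proof -
      have "l \<in> range (idx :: 'n \<Rightarrow> nat)"
        using that assms bij_betw_idx[where 'n = 'n] by (auto simp: bij_betw_def)
      then show ?thesis using that by auto
    qed
    then show "idx ` {i :: 'n. idx i < k} = {..<k}" by auto
  qed simp
  then show ?thesis by (rule sum.reindex_bij_betw)
qed

text \<open>Weights in [0,1] of total at most \<open>k\<close> do best on the \<open>k\<close>
  largest entries. Subtracting the threshold \<open>c m\<close>, where \<open>k = Suc m\<close>,
  makes the entries nonnegative up to that index and nonpositive after it, so the comparison is
  termwise.\<close>

lemma weighted_sum_le_top_sum:
  fixes c :: "nat \<Rightarrow> real" and q :: "'n::finite \<Rightarrow> real"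
  assumes c: "nonneg_decreasing CARD('n) c" and q: "\<And>i. 0 \<le> q i" "\<And>i. q i \<le> 1"
    and sum: "(\<Sum>i\<in>UNIV. q i) \<le> real k" and k: "k \<le> CARD('n)"
  shows "(\<Sum>i\<in>UNIV. c (idx i) * q i) \<le> (\<Sum>l<k. c l)"
proof (cases k)
  case 0
  then have "(\<Sum>i\<in>UNIV. q i) = 0" using sum q sum_nonneg[of UNIV q] by auto
  then have "\<forall>i. q i = 0" using q by (simp add: sum_nonneg_eq_0_iff)
  then show ?thesis using 0 by simp
next
  case (Suc m)
  let ?top = "{i :: 'n. idx i < k}"
  have "(\<Sum>i\<in>UNIV. (c (idx i) - c m) * q i) \<le> (\<Sum>i\<in>(UNIV :: 'n set). if idx i < k then c (idx i) - c m else 0)"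
  proof (rule sum_mono)
    fix i :: 'n
    show "(c (idx i) - c m) * q i \<le> (if idx i < k then c (idx i) - c m else 0)"
    proof (cases "idx i < k")
      case True
      then have "c m \<le> c (idx i)" using c k Suc by (auto simp: nonneg_decreasing_def)
      then show ?thesis using True q(2)[of i] by (simp add: mult_left_le)
    next
      case False
      then have "c (idx i) \<le> c m" using c Suc by (auto simp: nonneg_decreasing_def)
      then show ?thesis using False q(1)[of i] by (simp add: mult_nonpos_nonneg)
    qed
  qed
  also have "\<dots> = (\<Sum>i\<in>?top. c (idx i) - c m)" by (simp add: sum.If_cases)
  also have "\<dots> = (\<Sum>l<k. c l - c m)" using k by (rule sum_idx_less)
  finally have "(\<Sum>i\<in>UNIV. c (idx i) * q i) \<le> (\<Sum>l<k. c l) + c m * ((\<Sum>i\<in>UNIV. q i) - real k)"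
    by (simp add: algebra_simps sum_subtractf sum_distrib_left)
  \<comment> \<open>The total weight may fall short of \<open>k\<close>; since the threshold is
    nonnegative, this only lowers the sum.\<close>
  also have "c m * ((\<Sum>i\<in>UNIV. q i) - real k) \<le> 0"
    using c k Suc sum by (intro mult_nonneg_nonpos) (auto simp: nonneg_decreasing_def)
  finally show ?thesis by simp
qed

text \<open>Summation by parts: as \<open>a\<close> decreases and the partial sums of
  \<open>h\<close> are nonnegative, induction keeps the weighted sum above the last coefficient
  times the partial sum of \<open>h\<close>.\<close>

lemma Abel_sum_nonneg:
  fixes a h :: "nat \<Rightarrow> real"
  assumes a: "nonneg_decreasing n a" and h: "\<And>m. m \<le> n \<Longrightarrow> 0 \<le> (\<Sum>k<m. h k)"
  shows "0 \<le> (\<Sum>k<n. a k * h k)"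
proof -
  have "a m * (\<Sum>k<Suc m. h k) \<le> (\<Sum>k<Suc m. a k * h k)" if "m < n" for m
    using that
  proof (induction m)
    case (Suc m)
    have "a (Suc m) * (\<Sum>k<Suc m. h k) \<le> a m * (\<Sum>k<Suc m. h k)"
      using Suc.prems a h[of "Suc m"] by (intro mult_right_mono) (auto simp: nonneg_decreasing_def)
    also have "\<dots> \<le> (\<Sum>k<Suc m. a k * h k)" using Suc by simp
    finally show ?case by (simp add: algebra_simps)
  qed simp
  then show ?thesis
  proof (cases n)
    case (Suc m)
    have "0 \<le> a m * (\<Sum>k<n. h k)"
      using a h[of n] Suc by (intro mult_nonneg_nonneg) (auto simp: nonneg_decreasing_def)
    also have "\<dots> \<le> (\<Sum>k<n. a k * h k)"
      using \<open>\<And>m. m < n \<Longrightarrow> a m * (\<Sum>k<Suc m. h k) \<le> (\<Sum>k<Suc m. a k * h k)\<close>[of m] Suc by simp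
    finally show ?thesis .
  qed simp
qed

text \<open>Applying \<open>Q\<close> to \<open>b\<close> gives a sequence whose partial sums never
  exceed those of \<open>b\<close>, by \<open>weighted_sum_le_top_sum\<close> with partial column
  sums as weights. Pairing the difference with the decreasing \<open>a\<close> gives the bound by
  Abel summation.\<close>

lemma doubly_stochastic_rearrangement:
  fixes a b :: "nat \<Rightarrow> real" and Q :: "'n::finite \<Rightarrow> 'n \<Rightarrow> real"
  assumes a: "nonneg_decreasing CARD('n) a" and b: "nonneg_decreasing CARD('n) b"
    and Q: "\<And>i j. 0 \<le> Q i j" "\<And>i. (\<Sum>j\<in>UNIV. Q i j) = 1" "\<And>j. (\<Sum>i\<in>UNIV. Q i j) = 1"
  shows "(\<Sum>i\<in>UNIV. \<Sum>j\<in>UNIV. a (idx i) * b (idx j) * Q i j) \<le> (\<Sum>k<CARD('n). a k * b k)"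
proof -
  define g where "g k = (\<Sum>j\<in>UNIV. b (idx j) * Q (inv idx k) j)" for k
  have inv: "inv idx (idx i) = i" for i :: 'n
    by (rule inv_f_f) (simp add: inj_on_def)
  have "0 \<le> (\<Sum>k<CARD('n). a k * (b k - g k))"
  proof (rule Abel_sum_nonneg[OF a])
    fix m assume m: "m \<le> CARD('n)"
    let ?top = "{i :: 'n. idx i < m}"
    have "(\<Sum>k<m. g k) = (\<Sum>i\<in>?top. g (idx i))" using m by (rule sum_idx_less[symmetric])
    also have "\<dots> = (\<Sum>j\<in>UNIV. b (idx j) * (\<Sum>i\<in>?top. Q i j))"
      by (simp add: g_def inv sum_distrib_left sum.swap[of _ UNIV])
    also have "\<dots> \<le> (\<Sum>l<m. b l)"
    proof (rule weighted_sum_le_top_sum[OF b])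
      show "0 \<le> (\<Sum>i\<in>?top. Q i j)" for j using Q(1) by (intro sum_nonneg)
      show "(\<Sum>i\<in>?top. Q i j) \<le> 1" for j
        unfolding Q(3)[of j, symmetric] using Q(1) by (intro sum_mono2) auto
      have "(\<Sum>j\<in>UNIV. \<Sum>i\<in>?top. Q i j) = (\<Sum>i\<in>?top. 1)"
        by (subst sum.swap) (simp add: Q(2))
      also have "\<dots> = (\<Sum>l<m. 1 :: real)" using m by (rule sum_idx_less)
      finally show "(\<Sum>j\<in>UNIV. \<Sum>i\<in>?top. Q i j) \<le> real m" by simp
    qed (rule m)
    finally show "0 \<le> (\<Sum>k<m. b k - g k)" by (simp add: sum_subtractf)
  qed
  also have "\<dots> = (\<Sum>k<CARD('n). a k * b k) - (\<Sum>k<CARD('n). a k * g k)"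
    by (simp add: right_diff_distrib sum_subtractf)
  also have "(\<Sum>k<CARD('n). a k * g k) = (\<Sum>i\<in>(UNIV :: 'n set). a (idx i) * g (idx i))"
    by (rule sum_idx[symmetric])
  also have "\<dots> = (\<Sum>i\<in>UNIV. \<Sum>j\<in>UNIV. a (idx i) * b (idx j) * Q i j)"
    by (simp add: g_def inv sum_distrib_left mult.assoc)
  finally show ?thesis by simp
qed

lemma braket_schmidt_state:
  "braket (schmidt_state a) \<phi> = (\<Sum>i\<in>UNIV. of_real (a (idx i)) * \<phi> $ (i, i))"
proof -
  have "braket (schmidt_state a) \<phi> =
    (\<Sum>i\<in>UNIV. \<Sum>j\<in>UNIV. if i = j then of_real (a (idx i)) * \<phi> $ (i, j) else 0)"
    unfolding braket_def schmidt_state_def sum_UNIV_prod by (intro sum.cong refl) auto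
  then show ?thesis by simp
qed

text \<open>This is von Neumann's trace inequality, read in terms of bipartite states.\<close>
lemma cmod_braket_schmidt_le:
  fixes a b :: "nat \<Rightarrow> real"
  assumes U: "unitary_matrix U" and V: "unitary_matrix V"
    and U': "unitary_matrix U'" and V': "unitary_matrix V'"
    and a: "nonneg_decreasing CARD('n) a" and b: "nonneg_decreasing CARD('n) b"
  shows "cmod (braket (kron U V *v schmidt_state a) (kron U' V' *v (schmidt_state b :: 'n::finite bistate)))
    \<le> (\<Sum>k<CARD('n). a k * b k)"
proof -
  define X where "X = dagger U ** U'"
  define Y where "Y = dagger V ** V'"
  have XY: "unitary_matrix X" "unitary_matrix Y"
    by (simp_all add: X_def Y_def assms unitary_mult unitary_dagger)
  have pos: "0 \<le> a (idx i)" "0 \<le> b (idx i)" for i :: 'n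
    using a b idx_less[of i] by (auto simp: nonneg_decreasing_def)
  have "braket (kron U V *v schmidt_state a) (kron U' V' *v (schmidt_state b :: 'n bistate)) =
    braket (schmidt_state a) (kron X Y *v schmidt_state b)"
    by (simp add: braket_adjoint dagger_kron kron_mult X_def Y_def matrix_vector_mul_assoc)
  also have "\<dots> = (\<Sum>i\<in>UNIV. \<Sum>j\<in>UNIV. of_real (a (idx i) * b (idx j)) * (X $ i $ j * Y $ i $ j))"
    by (simp add: braket_schmidt_state kron_schmidt_state sum_distrib_left mult_ac)
  \<comment> \<open>The product of two moduli is at most the mean of their squares. For unitary
    \<open>X\<close> and \<open>Y\<close> these means form a doubly stochastic matrix.\<close>
  also have "cmod \<dots> \<le> (\<Sum>i\<in>UNIV. \<Sum>j\<in>UNIV. a (idx i) * b (idx j) *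
      (((cmod (X $ i $ j))\<^sup>2 + (cmod (Y $ i $ j))\<^sup>2) / 2))"
  proof (intro order_trans[OF norm_sum] sum_mono)
    fix i j :: 'n
    have "cmod (X $ i $ j) * cmod (Y $ i $ j) \<le> ((cmod (X $ i $ j))\<^sup>2 + (cmod (Y $ i $ j))\<^sup>2) / 2"
      using sum_squares_bound[of "cmod (X $ i $ j)" "cmod (Y $ i $ j)"] by simp
    with pos show "cmod (of_real (a (idx i) * b (idx j)) * (X $ i $ j * Y $ i $ j)) \<le>
      a (idx i) * b (idx j) * (((cmod (X $ i $ j))\<^sup>2 + (cmod (Y $ i $ j))\<^sup>2) / 2)"
      unfolding norm_mult norm_of_real by (intro mult_mono) auto
  qed
  also have "\<dots> \<le> (\<Sum>k<CARD('n). a k * b k)"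
    by (rule doubly_stochastic_rearrangement[OF a b])
      (simp_all add: sum.distrib unitary_row_sum unitary_column_sum XY flip: sum_divide_distrib)
  finally show ?thesis .
qed

section \<open>Ky Fan's maximum principle for Bob's reduced state\<close>

lemma norm_contract_B_schmidt_state:
  "(norm (contract_B x (schmidt_state d :: 'n::finite bistate)))\<^sup>2 =
    (\<Sum>i\<in>UNIV. (d (idx i))\<^sup>2 * (cmod (x $ i))\<^sup>2)"
proof -
  have "contract_B x (schmidt_state d :: 'n bistate) $ i = cnj (x $ i) * of_real (d (idx i))" for i
  proof -
    have "contract_B x (schmidt_state d :: 'n bistate) $ i =
      (\<Sum>k\<in>UNIV. if i = k then cnj (x $ k) * of_real (d (idx i)) else 0)"
      unfolding contract_B_def schmidt_state_def vec_lambda_beta by (intro sum.cong refl) auto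
    then show ?thesis by simp
  qed
  then show ?thesis
    unfolding norm_vec_def L2_set_def
    by (subst real_sqrt_pow2) (simp_all add: sum_nonneg norm_mult power_mult_distrib mult_ac)
qed

lemma matrix_vector_axis: "(A *v axis j 1) $ i = A $ i $ j"
  by (simp add: matrix_vector_mult_def axis_def if_distrib cong: if_cong)

text \<open>\<open>(norm (contract_B w \<psi>))\<^sup>2\<close> is \<open>\<langle>w, \<rho>\<^sub>B w\<rangle>\<close>, where \<open>\<rho>\<^sub>B\<close> is Bob's reduced state.\<close>
lemma sum_norm_contract_B_le:
  fixes \<psi> :: "'n::finite bistate"
  assumes W: "unitary_matrix W" and k: "k \<le> CARD('n)"
  shows "(\<Sum>j | idx j < k. (norm (contract_B (W *v axis j 1) \<psi>))\<^sup>2) \<le> (\<Sum>l<k. (norm \<psi>)\<^sup>2 * schmidt \<psi> l)"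
proof -
  obtain U V d where U: "unitary_matrix U" and V: "unitary_matrix V"
    and d: "nonneg_decreasing CARD('n) d" and \<psi>: "\<psi> = kron U V *v schmidt_state d"
    by (rule schmidt_decomposition)
  \<comment> \<open>\<open>X\<close> expresses the trial basis \<open>W\<close> in Bob's Schmidt
    basis \<open>V\<close>.\<close>
  define X where "X = dagger V ** W"
  have X: "unitary_matrix X" by (simp add: X_def V W unitary_mult unitary_dagger)
  have "W = V ** X" using V by (simp add: X_def matrix_mul_assoc unitary_matrix_def)
  then have "contract_B (W *v axis j 1) \<psi> = U *v contract_B (X *v axis j 1) (schmidt_state d)" for j
    by (simp add: \<psi> contract_B_kron[OF V] flip: matrix_vector_mul_assoc)
  then have "(\<Sum>j | idx j < k. (norm (contract_B (W *v axis j 1) \<psi>))\<^sup>2) =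
      (\<Sum>j | idx j < k. \<Sum>i\<in>UNIV. (d (idx i))\<^sup>2 * (cmod (X $ i $ j))\<^sup>2)"
    by (simp add: unitary_norm[OF U] norm_contract_B_schmidt_state matrix_vector_axis)
  also have "\<dots> = (\<Sum>i\<in>UNIV. (d (idx i))\<^sup>2 * (\<Sum>j | idx j < k. (cmod (X $ i $ j))\<^sup>2))"
    by (simp add: sum_distrib_left sum.swap[of _ UNIV])
  also have "\<dots> \<le> (\<Sum>l<k. (d l)\<^sup>2)"
  \<comment> \<open>The weights are partial row sums of the squared moduli of \<open>X\<close>: each
    is at most a full row, that is 1, and together they make up \<open>k\<close> full
    columns.\<close>
  proof (rule weighted_sum_le_top_sum[where c = "\<lambda>l. (d l)\<^sup>2"])
    show "nonneg_decreasing CARD('n) (\<lambda>l. (d l)\<^sup>2)"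
      using d by (simp add: nonneg_decreasing_def power_mono)
    show "0 \<le> (\<Sum>j | idx j < k. (cmod (X $ i $ j))\<^sup>2)" for i by (simp add: sum_nonneg)
    show "(\<Sum>j | idx j < k. (cmod (X $ i $ j))\<^sup>2) \<le> 1" for i
      unfolding unitary_row_sum[OF X, of i, symmetric] by (intro sum_mono2) auto
    have "(\<Sum>i\<in>UNIV. \<Sum>j | idx j < k. (cmod (X $ i $ j))\<^sup>2) = (\<Sum>j | idx (j :: 'n) < k. 1)"
      by (subst sum.swap) (simp add: unitary_column_sum[OF X])
    also have "\<dots> = (\<Sum>l<k. 1 :: real)" using k by (rule sum_idx_less)
    finally show "(\<Sum>i\<in>UNIV. \<Sum>j | idx j < k. (cmod (X $ i $ j))\<^sup>2) \<le> real k" by simp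
  qed (rule k)
  also have "\<dots> = (\<Sum>l<k. (norm \<psi>)\<^sup>2 * schmidt \<psi> l)"
    using k by (intro sum.cong refl norm_square_mult_schmidt[OF U V d \<psi>, symmetric]) auto
  finally show ?thesis .
qed

text \<open>The Ky Fan bound is attained: the columns of \<open>V\<close> in a Schmidt decomposition
  diagonalise Bob's reduced state in decreasing order, and one \<open>W\<close> serves every
  \<open>k\<close>.\<close>

lemma ex_unitary_sum_norm_contract_B:
  fixes \<psi> :: "'n::finite bistate"
  obtains W where "unitary_matrix W" "\<And>k. k \<le> CARD('n) \<Longrightarrow>
    (\<Sum>j | idx j < k. (norm (contract_B (W *v axis j 1) \<psi>))\<^sup>2) = (\<Sum>l<k. (norm \<psi>)\<^sup>2 * schmidt \<psi> l)"
proof -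
  obtain U V d where U: "unitary_matrix U" and V: "unitary_matrix V"
    and d: "nonneg_decreasing CARD('n) d" and \<psi>: "\<psi> = kron U V *v schmidt_state d"
    by (rule schmidt_decomposition)
  have "(norm (contract_B (V *v axis j 1) \<psi>))\<^sup>2 = (norm \<psi>)\<^sup>2 * schmidt \<psi> (idx j)" for j
  proof -
    have "(norm (contract_B (V *v axis j 1) \<psi>))\<^sup>2 =
        (\<Sum>i\<in>UNIV. (d (idx i))\<^sup>2 * (cmod (axis j 1 $ i))\<^sup>2)"
      unfolding \<psi> contract_B_kron[OF V] unitary_norm[OF U] by (rule norm_contract_B_schmidt_state)
    also have "\<dots> = (\<Sum>i\<in>UNIV. if i = j then (d (idx i))\<^sup>2 else 0)"
      by (intro sum.cong refl) (auto simp: axis_def)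
    also have "\<dots> = (d (idx j))\<^sup>2" by simp
    also have "\<dots> = (norm \<psi>)\<^sup>2 * schmidt \<psi> (idx j)"
      by (rule norm_square_mult_schmidt[OF U V d \<psi> idx_less, symmetric])
    finally show ?thesis .
  qed
  then show ?thesis
    using that[OF V] sum_idx_less[where 'n = 'n and g = "\<lambda>l. (norm \<psi>)\<^sup>2 * schmidt \<psi> l"] by simp
qed

section \<open>LOCC protocols and approximability\<close>

lemma norm_eq_1_iff_square: "(norm x)\<^sup>2 = 1 \<longleftrightarrow> norm x = 1"
  by (simp add: abs_square_eq_1)

lemma braket_self_eq_1_iff: "braket x x = 1 \<longleftrightarrow> norm x = 1"
  unfolding braket_self of_real_eq_1_iff norm_eq_1_iff_square ..

text \<open>Taking the convex hull adds no pure state to the generators, and the Schmidt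
  coefficients of a unit vector depend only on its projector.\<close>

lemma ketbra_in_S_mu_iff:
  fixes \<xi> :: "'n::finite bistate"
  assumes "norm \<xi> = 1"
  shows "ketbra \<xi> \<in> S_mu \<mu> \<longleftrightarrow> majorizes CARD('n) (schmidt \<xi>) \<mu>"
proof
  assume "ketbra \<xi> \<in> S_mu \<mu>"
  then have "ketbra \<xi> \<in> {ketbra \<psi> | \<psi> :: 'n bistate. braket \<psi> \<psi> = 1 \<and> majorizes CARD('n) (schmidt \<psi>) \<mu>}"
    unfolding S_mu_def by (rule pure_in_convex_hull[OF assms, rotated]) (auto simp: braket_self_eq_1_iff)
  then obtain \<phi> :: "'n bistate" where \<phi>: "ketbra \<xi> = ketbra \<phi>" "braket \<phi> \<phi> = 1"
    "majorizes CARD('n) (schmidt \<phi>) \<mu>" by blast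
  have "braket \<xi> \<xi> = 1" using assms by (simp add: braket_self_eq_1_iff)
  with \<phi> have "schmidt \<xi> = schmidt \<phi>" by (simp add: schmidt_def fun_eq_iff)
  with \<phi> show "majorizes CARD('n) (schmidt \<xi>) \<mu>" by simp
next
  assume "majorizes CARD('n) (schmidt \<xi>) \<mu>"
  then show "ketbra \<xi> \<in> S_mu \<mu>"
    unfolding S_mu_def using assms by (intro hull_inc) (auto simp: braket_self_eq_1_iff)
qed

lemma ketbra_in_S_mu_f_iff:
  fixes \<psi> :: "'n::finite bistate"
  assumes "norm \<psi> = 1"
  shows "ketbra \<psi> \<in> S_mu_f \<mu> f \<longleftrightarrow>
    (\<exists>\<xi> :: 'n bistate. norm \<xi> = 1 \<and> majorizes CARD('n) (schmidt \<xi>) \<mu> \<and> f \<le> cmod (braket \<xi> \<psi>))"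
proof
  assume "ketbra \<psi> \<in> S_mu_f \<mu> f"
  then have "ketbra \<psi> \<in> {ketbra \<psi> | \<psi> :: 'n bistate. braket \<psi> \<psi> = 1 \<and>
      (\<exists>\<xi>. braket \<xi> \<xi> = 1 \<and> ketbra \<xi> \<in> S_mu \<mu> \<and> f \<le> cmod (braket \<xi> \<psi>))}"
    unfolding S_mu_f_def by (rule pure_in_convex_hull[OF assms, rotated]) (auto simp: braket_self_eq_1_iff)
  then obtain \<phi> \<xi> :: "'n bistate" where *: "ketbra \<psi> = ketbra \<phi>" "norm \<xi> = 1"
    "ketbra \<xi> \<in> S_mu \<mu>" "f \<le> cmod (braket \<xi> \<phi>)" by (auto simp: braket_self_eq_1_iff)
  \<comment> \<open>The generator \<phi> may differ from \<psi> by a phase, but overlaps with \<xi>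
    have the same modulus because the projectors agree.\<close>
  have "complex_of_real ((cmod (braket \<xi> \<psi>))\<^sup>2) = of_real ((cmod (braket \<xi> \<phi>))\<^sup>2)"
    unfolding cmod_braket_ketbra *(1) ..
  then have "cmod (braket \<xi> \<psi>) = cmod (braket \<xi> \<phi>)"
    by (simp only: of_real_eq_iff power2_eq_iff_nonneg norm_ge_zero)
  with * show "\<exists>\<xi> :: 'n bistate. norm \<xi> = 1 \<and> majorizes CARD('n) (schmidt \<xi>) \<mu> \<and> f \<le> cmod (braket \<xi> \<psi>)"
    by (auto simp: ketbra_in_S_mu_iff)
next
  assume "\<exists>\<xi> :: 'n bistate. norm \<xi> = 1 \<and> majorizes CARD('n) (schmidt \<xi>) \<mu> \<and> f \<le> cmod (braket \<xi> \<psi>)"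
  then have "\<exists>\<xi>. braket \<xi> \<xi> = 1 \<and> ketbra \<xi> \<in> S_mu \<mu> \<and> f \<le> cmod (braket \<xi> \<psi>)"
    using ketbra_in_S_mu_iff braket_self_eq_1_iff by blast
  moreover have "braket \<psi> \<psi> = 1" using assms by (simp add: braket_self_eq_1_iff)
  ultimately show "ketbra \<psi> \<in> S_mu_f \<mu> f"
    unfolding S_mu_f_def by (intro hull_inc) blast
qed

section \<open>Kraus families and the average Schmidt vector\<close>

lemma braket_add_right: "braket x (y + z) = braket x y + braket x z"
  by (simp add: braket_def algebra_simps sum.distrib)

lemma sum_braket_kraus:
  fixes m :: nat
  assumes "(\<Sum>i<m. dagger (K i) ** K i) = mat 1"
  shows "(\<Sum>i<m. braket (K i *v x) (K i *v y)) = braket x y"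
proof -
  have "(\<Sum>i<m. braket (K i *v x) (K i *v y)) = braket x ((\<Sum>i<m. dagger (K i) ** K i) *v y)"
  proof (induction m)
    case 0
    show ?case by (simp add: braket_def)
  next
    case (Suc m)
    then show ?case
      by (simp add: braket_adjoint matrix_vector_mult_add_rdistrib braket_add_right
          matrix_vector_mul_assoc)
  qed
  then show ?thesis by (simp add: assms)
qed

lemma sum_norm_kraus:
  fixes m :: nat
  assumes "(\<Sum>i<m. dagger (K i) ** K i) = mat 1"
  shows "(\<Sum>i<m. (norm (K i *v x))\<^sup>2) = (norm x)\<^sup>2"
proof -
  have "complex_of_real (\<Sum>i<m. (norm (K i *v x))\<^sup>2) = of_real ((norm x)\<^sup>2)"
    using sum_braket_kraus[OF assms, of x x] by (simp only: of_real_sum braket_self)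
  then show ?thesis by (simp only: of_real_eq_iff)
qed

text \<open>The local unitaries cancel in each term, so the completeness relation of Alice's
  measurement passes to the joint operators.\<close>

lemma sum_dagger_kron_kraus:
  fixes m :: nat
  assumes A: "(\<Sum>i<m. dagger (A i) ** A i) = (mat 1 :: complex ^ 'n::finite ^ 'n)"
    and U: "\<And>i. i < m \<Longrightarrow> unitary_matrix (U i)"
    and V: "\<And>i. i < m \<Longrightarrow> unitary_matrix (V i)"
  shows "(\<Sum>i<m. dagger (kron (U i ** A i) (V i)) ** kron (U i ** A i) (V i)) =
    (mat 1 :: complex ^ ('n \<times> 'n) ^ ('n \<times> 'n))"
proof -
  have "dagger (kron (U i ** A i) (V i)) ** kron (U i ** A i) (V i) =
      kron (dagger (A i) ** A i) (mat 1 :: complex ^ 'n ^ 'n)" if "i < m" for i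
  proof -
    have "dagger (A i) ** dagger (U i) ** (U i ** A i) = dagger (A i) ** (dagger (U i) ** U i) ** A i"
      by (simp only: matrix_mul_assoc)
    then show ?thesis
      using U[OF that] V[OF that] by (simp add: dagger_kron kron_mult dagger_mult unitary_matrix_def)
  qed
  then have "(\<Sum>i<m. dagger (kron (U i ** A i) (V i)) ** kron (U i ** A i) (V i)) =
      (\<Sum>i<m. kron (dagger (A i) ** A i) (mat 1 :: complex ^ 'n ^ 'n))"
    by (intro sum.cong) auto
  also have "\<dots> = kron (\<Sum>i<m. dagger (A i) ** A i) (mat 1 :: complex ^ 'n ^ 'n)"
    by (simp add: kron_def vec_eq_iff sum_distrib_right)
  also have "\<dots> = mat 1"
    unfolding A by (rule kron_mat_1)
  finally show ?thesis .
qed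

text \<open>Take vectors of Bob that attain the Ky Fan sum for \<xi>. Alice's Kraus family preserves
  the total squared norm of their contractions. Rotated by \<open>V i\<close>, they become trial
  vectors for outcome \<open>i\<close>, where Ky Fan gives an upper bound.\<close>

lemma sum_schmidt_kraus_ge:
  fixes \<xi> :: "'n::finite bistate" and m :: nat
  assumes A: "(\<Sum>i<m. dagger (A i) ** A i) = mat 1"
    and U: "\<And>i. i < m \<Longrightarrow> unitary_matrix (U i)"
    and V: "\<And>i. i < m \<Longrightarrow> unitary_matrix (V i)"
    and k: "k \<le> CARD('n)"
  defines "\<phi> \<equiv> \<lambda>i. kron (U i ** A i) (V i) *v \<xi>"
  shows "(\<Sum>l<k. (norm \<xi>)\<^sup>2 * schmidt \<xi> l) \<le> (\<Sum>l<k. \<Sum>i<m. (norm (\<phi> i))\<^sup>2 * schmidt (\<phi> i) l)"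
proof -
  obtain W where W: "unitary_matrix W" and sum:
    "(\<Sum>j | idx j < k. (norm (contract_B (W *v axis j 1) \<xi>))\<^sup>2) = (\<Sum>l<k. (norm \<xi>)\<^sup>2 * schmidt \<xi> l)"
    using ex_unitary_sum_norm_contract_B[of \<xi>] k by metis
  let ?x = "\<lambda>j. contract_B (W *v axis j 1) \<xi>"
  have "(\<Sum>l<k. (norm \<xi>)\<^sup>2 * schmidt \<xi> l) = (\<Sum>j | idx j < k. \<Sum>i<m. (norm (A i *v ?x j))\<^sup>2)"
    by (simp only: sum_norm_kraus[OF A] sum)
  also have "\<dots> = (\<Sum>i<m. \<Sum>j | idx j < k. (norm (A i *v ?x j))\<^sup>2)"
    by (rule sum.swap)
  also have "\<dots> = (\<Sum>i<m. \<Sum>j | idx j < k. (norm (contract_B ((V i ** W) *v axis j 1) (\<phi> i)))\<^sup>2)"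
    by (intro sum.cong refl)
      (simp add: \<phi>_def contract_B_kron V U unitary_norm flip: matrix_vector_mul_assoc)
  also have "\<dots> \<le> (\<Sum>i<m. \<Sum>l<k. (norm (\<phi> i))\<^sup>2 * schmidt (\<phi> i) l)"
    using V W k by (intro sum_mono sum_norm_contract_B_le unitary_mult) auto
  also have "\<dots> = (\<Sum>l<k. \<Sum>i<m. (norm (\<phi> i))\<^sup>2 * schmidt (\<phi> i) l)"
    by (rule sum.swap)
  finally show ?thesis .
qed

section \<open>From a protocol to approximability\<close>

lemma S_mu_f_plus_imp_approximable:
  fixes \<rho> :: "'n::finite biop"
  assumes "\<rho> \<in> S_mu_f_plus \<mu> f"
  shows "approximable \<mu> f \<rho>"
proof -
  obtain L and \<psi> :: "'n bistate" where L: "L \<in> LOCC1A" and \<rho>: "\<rho> = L (ketbra \<psi>)"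
    and \<psi>: "norm \<psi> = 1" "ketbra \<psi> \<in> S_mu_f \<mu> f"
    using assms unfolding S_mu_f_plus_def by (auto simp: braket_self_eq_1_iff)
  obtain \<xi> :: "'n bistate" where \<xi>: "norm \<xi> = 1" "majorizes CARD('n) (schmidt \<xi>) \<mu>"
    "f \<le> cmod (braket \<xi> \<psi>)"
    using \<psi> by (auto simp: ketbra_in_S_mu_f_iff)
  obtain m and A U V :: "nat \<Rightarrow> 'n op" where LOCC:
    "(\<forall>i<m. \<forall>j<m. A i ** A j = A j ** A i) \<and> (\<Sum>i<m. dagger (A i) ** A i) = mat 1 \<and>
     (\<forall>i<m. unitary_matrix (U i) \<and> unitary_matrix (V i)) \<and>
     L = (\<lambda>\<sigma>. \<Sum>i<m. kron (U i ** A i) (V i) ** \<sigma> ** dagger (kron (U i ** A i) (V i)))"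
    using L unfolding LOCC1A_def by blast
  then have
    A: "(\<Sum>i<m. dagger (A i) ** A i) = mat 1" and
    UV: "\<And>i. i < m \<Longrightarrow> unitary_matrix (U i)" "\<And>i. i < m \<Longrightarrow> unitary_matrix (V i)" and
    L: "L = (\<lambda>\<sigma>. \<Sum>i<m. kron (U i ** A i) (V i) ** \<sigma> ** dagger (kron (U i ** A i) (V i)))"
    by simp_all
  define K where "K i = kron (U i ** A i) (V i)" for i
  have K: "(\<Sum>i<m. dagger (K i) ** K i) = mat 1"
    unfolding K_def by (rule sum_dagger_kron_kraus[OF A UV])
  have "\<rho> = (\<Sum>i<m. ketbra (K i *v \<psi>))"
    by (simp add: \<rho> L K_def ketbra_matrix_vector)
  moreover have "trace (\<Sum>i<m. ketbra (K i *v \<xi>)) = 1"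
    using sum_norm_kraus[OF K, of \<xi>] \<xi>(1)
    by (simp only: trace_sum trace_ketbra flip: of_real_sum) simp
  moreover have "majorizes CARD('n)
      (\<lambda>k. \<Sum>i<m. Re (braket (K i *v \<xi>) (K i *v \<xi>)) * schmidt (K i *v \<xi>) k) \<mu>"
    unfolding majorizes_def
  proof
    fix k assume k: "k \<in> {1..CARD('n)}"
    then have "(\<Sum>l<k. \<mu> l) \<le> (\<Sum>l<k. (norm \<xi>)\<^sup>2 * schmidt \<xi> l)"
      using \<xi> by (simp add: majorizes_def)
    also have "\<dots> \<le> (\<Sum>l<k. \<Sum>i<m. (norm (K i *v \<xi>))\<^sup>2 * schmidt (K i *v \<xi>) l)"
      unfolding K_def using k by (intro sum_schmidt_kraus_ge[OF A UV]) auto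
    finally show "(\<Sum>l<k. \<mu> l) \<le>
        (\<Sum>l<k. \<Sum>i<m. Re (braket (K i *v \<xi>) (K i *v \<xi>)) * schmidt (K i *v \<xi>) l)"
      by (simp only: braket_self Re_complex_of_real)
  qed
  \<comment> \<open>The complex overlap itself is conserved by the Kraus family; the triangle
    inequality then passes to the sum of moduli.\<close>
  moreover have "f \<le> (\<Sum>i<m. cmod (braket (K i *v \<psi>) (K i *v \<xi>)))"
  proof -
    have "f \<le> cmod (braket \<psi> \<xi>)"
      using \<xi>(3) complex_mod_cnj[of "braket \<psi> \<xi>"] by (simp add: cnj_braket)
    also have "braket \<psi> \<xi> = (\<Sum>i<m. braket (K i *v \<psi>) (K i *v \<xi>))"
      by (rule sum_braket_kraus[OF K, symmetric])
    also have "cmod \<dots> \<le> (\<Sum>i<m. cmod (braket (K i *v \<psi>) (K i *v \<xi>)))" by (rule norm_sum)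
    finally show ?thesis .
  qed
  ultimately show ?thesis unfolding approximable_def
    by (intro exI[of _ m] exI[of _ "\<lambda>i. K i *v \<psi>"] exI[of _ "\<lambda>i. K i *v \<xi>"] conjI)
qed

section \<open>From approximability to a diagonal protocol\<close>

lemma diag_matrix_mult: "diag_matrix c ** diag_matrix d = diag_matrix (\<lambda>i. c i * (d i :: 'a::semiring_1))"
proof -
  have "(\<Sum>k\<in>UNIV. (if i = k then c i else 0) * (if k = j then d k else 0)) =
      (\<Sum>k\<in>UNIV. if i = k then (if i = j then c i * d i else 0) else 0)" for i j
    by (intro sum.cong refl) auto
  then show ?thesis by (simp add: diag_matrix_def matrix_matrix_mult_def vec_eq_iff)
qed

lemma dagger_diag_matrix: "dagger (diag_matrix c) = diag_matrix (\<lambda>i. cnj (c i))"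
  by (auto simp: diag_matrix_def dagger_def vec_eq_iff)

text \<open>This lets the diagonal Kraus operator with entries \<open>c i k\<close> turn the
  coefficients \<open>s\<close> into \<open>a i\<close>, with the local unitaries acting
  afterwards.\<close>

lemma kron_diag_schmidt_state:
  "kron (U ** diag_matrix (\<lambda>i. of_real (c (idx i)))) V *v schmidt_state s =
    kron U V *v schmidt_state (\<lambda>k. c k * s k)"
proof -
  have "(U ** diag_matrix (\<lambda>i. of_real (c (idx i)))) $ i $ j = U $ i $ j * of_real (c (idx j))" for i j
    by (simp add: diag_matrix_def matrix_matrix_mult_def if_distrib if_distribR cong: if_cong)
  then show ?thesis by (simp add: vec_eq_iff kron_schmidt_state mult_ac)
qed

lemma approximable_imp_S_mu_f_plus:
  fixes \<rho> :: "'n::finite biop"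
  assumes \<rho>: "density_matrix \<rho>" and "approximable \<mu> f \<rho>"
  shows "\<rho> \<in> S_mu_f_plus \<mu> f"
proof -
  obtain m and \<psi> \<psi>' :: "nat \<Rightarrow> 'n bistate" where
    dec: "\<rho> = (\<Sum>i<m. ketbra (\<psi> i))" and
    tr': "trace (\<Sum>i<m. ketbra (\<psi>' i)) = 1" and
    maj: "majorizes CARD('n) (\<lambda>k. \<Sum>i<m. Re (braket (\<psi>' i) (\<psi>' i)) * schmidt (\<psi>' i) k) \<mu>" and
    f: "f \<le> (\<Sum>i<m. cmod (braket (\<psi> i) (\<psi>' i)))"
    using assms unfolding approximable_def by blast
  have "\<forall>i. \<exists>U V d. unitary_matrix U \<and> unitary_matrix V \<and> nonneg_decreasing CARD('n) d \<and>
      \<psi> i = kron U V *v schmidt_state d" by (metis schmidt_decomposition)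
  then obtain U V a where \<psi>: "\<And>i. unitary_matrix (U i)" "\<And>i. unitary_matrix (V i)"
    "\<And>i. nonneg_decreasing CARD('n) (a i)" "\<And>i. \<psi> i = kron (U i) (V i) *v schmidt_state (a i)"
    by metis
  have "\<forall>i. \<exists>U V d. unitary_matrix U \<and> unitary_matrix V \<and> nonneg_decreasing CARD('n) d \<and>
      \<psi>' i = kron U V *v schmidt_state d" by (metis schmidt_decomposition)
  then obtain U' V' b where \<psi>': "\<And>i. unitary_matrix (U' i)" "\<And>i. unitary_matrix (V' i)"
    "\<And>i. nonneg_decreasing CARD('n) (b i)" "\<And>i. \<psi>' i = kron (U' i) (V' i) *v schmidt_state (b i)"
    by metis
  define s where "s k = sqrt (\<Sum>i<m. (a i k)\<^sup>2)" for k
  define t where "t k = sqrt (\<Sum>i<m. (b i k)\<^sup>2)" for k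
  have s2: "(s k)\<^sup>2 = (\<Sum>i<m. (a i k)\<^sup>2)" and t2: "(t k)\<^sup>2 = (\<Sum>i<m. (b i k)\<^sup>2)" for k
    by (simp_all add: s_def t_def sum_nonneg)
  \<comment> \<open>Both sides are the double sum of \<open>(c i k)\<^sup>2\<close> over outcomes
    and coefficients, taken in the two orders. It serves both \<open>s\<close> and
    \<open>t\<close>.\<close>
  have norm_eq: "(norm (schmidt_state r :: 'n bistate))\<^sup>2 = (\<Sum>i<m. (norm (\<phi> i))\<^sup>2)"
    if "\<And>k. (r k)\<^sup>2 = (\<Sum>i<m. (c i k)\<^sup>2)" "\<And>i. \<phi> i = kron (P i) (Q i) *v schmidt_state (c i)"
      "\<And>i. unitary_matrix (P i)" "\<And>i. unitary_matrix (Q i)"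
    for r c and \<phi> :: "nat \<Rightarrow> 'n bistate" and P Q :: "nat \<Rightarrow> 'n op"
    using that by (simp add: norm_schmidt_state unitary_norm unitary_kron sum.swap[of _ "{..<CARD('n)}"])
  \<comment> \<open>An empty family has trace zero. Outcome 0 must exist, since it takes over the
    coordinates where \<open>s\<close> vanishes.\<close>
  have "m \<noteq> 0" using tr' by (intro notI) (simp add: trace_def)
  have norm_s: "norm (schmidt_state s :: 'n bistate) = 1"
  proof -
    have "complex_of_real (\<Sum>i<m. (norm (\<psi> i))\<^sup>2) = 1"
      using \<rho> by (simp only: density_matrix_def dec trace_sum trace_ketbra of_real_sum)
    then have "(norm (schmidt_state s :: 'n bistate))\<^sup>2 = 1"
      unfolding norm_eq[OF s2 \<psi>(4,1,2)] by (simp only: of_real_eq_1_iff)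
    then show ?thesis by (simp only: norm_eq_1_iff_square)
  qed
  have norm_t: "norm (schmidt_state t :: 'n bistate) = 1"
  proof -
    have "complex_of_real (\<Sum>i<m. (norm (\<psi>' i))\<^sup>2) = 1"
      using tr' by (simp only: trace_sum trace_ketbra of_real_sum)
    then have "(norm (schmidt_state t :: 'n bistate))\<^sup>2 = 1"
      unfolding norm_eq[OF t2 \<psi>'(4,1,2)] by (simp only: of_real_eq_1_iff)
    then show ?thesis by (simp only: norm_eq_1_iff_square)
  qed
  text \<open>Where \<open>s\<close> vanishes, all \<open>a i\<close> vanish, and the first Kraus operator absorbs the kernel.\<close>
  define c where "c i k = (if s k = 0 then of_bool (i = 0) else a i k / s k)" for i k
  define A where "A i = (diag_matrix (\<lambda>j. of_real (c i (idx j))) :: 'n op)" for i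
  have cs: "c i k * s k = a i k" if "i < m" for i k
  proof (cases "s k = 0")
    case True
    then have "(\<Sum>i<m. (a i k)\<^sup>2) = 0" using s2[of k] by simp
    then show ?thesis using that True by (simp add: sum_nonneg_eq_0_iff)
  qed (simp add: c_def)
  have c2: "(\<Sum>i<m. (c i k)\<^sup>2) = 1" for k
  proof (cases "s k = 0")
    case True
    then have "(c i k)\<^sup>2 = (if i = 0 then 1 else 0)" for i by (simp add: c_def)
    then show ?thesis using \<open>m \<noteq> 0\<close> by simp
  next
    case False
    then have "(\<Sum>i<m. (a i k)\<^sup>2) \<noteq> 0" by (simp flip: s2)
    then show ?thesis using False
      by (simp add: c_def power_divide s2 flip: sum_divide_distrib)
  qed
  have "A i ** A j = A j ** A i" for i j
    by (simp add: A_def diag_matrix_mult mult.commute)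
  moreover have "(\<Sum>i<m. dagger (A i) ** A i) = mat 1"
  proof -
    have "(\<Sum>i<m. dagger (A i) ** A i) = (\<Sum>i<m. diag_matrix (\<lambda>j. of_real ((c i (idx j))\<^sup>2)))"
      by (simp add: A_def diag_matrix_mult dagger_diag_matrix power2_eq_square)
    also have "\<dots> = diag_matrix (\<lambda>j. of_real (\<Sum>i<m. (c i (idx j))\<^sup>2))"
      by (simp add: diag_matrix_def vec_eq_iff)
    also have "\<dots> = mat 1" unfolding c2 by (simp add: diag_matrix_def mat_def)
    finally show ?thesis .
  qed
  ultimately have "(\<lambda>\<sigma>. \<Sum>i<m. kron (U i ** A i) (V i) ** \<sigma> ** dagger (kron (U i ** A i) (V i))) \<in> LOCC1A"
    (is "?L \<in> _") unfolding LOCC1A_def mem_Collect_eq using \<psi>(1,2)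
    by (intro exI[of _ m] exI[of _ A] exI[of _ U] exI[of _ V]) simp
  moreover have "\<rho> = ?L (ketbra (schmidt_state s))"
  proof -
    have "kron (U i ** A i) (V i) *v schmidt_state s = \<psi> i" if "i < m" for i
      by (simp add: A_def kron_diag_schmidt_state cs[OF that] \<psi>(4))
    then show ?thesis by (simp add: dec flip: ketbra_matrix_vector)
  qed
  moreover have "ketbra (schmidt_state s :: 'n bistate) \<in> S_mu_f \<mu> f"
  proof -
    have t: "nonneg_decreasing CARD('n) t"
      using \<psi>'(3) unfolding nonneg_decreasing_def t_def
      by (auto intro!: sum_nonneg sum_mono power_mono)
    \<comment> \<open>Identity unitaries exhibit this state as its own Schmidt decomposition, so
      \<open>norm_square_mult_schmidt\<close> reads off its coefficients
      \<open>(t k)\<^sup>2\<close>.\<close>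
    have id: "schmidt_state t = kron (mat 1) (mat 1) *v (schmidt_state t :: 'n bistate)"
      by (simp add: kron_mat_1)
    have "schmidt (schmidt_state t :: 'n bistate) k =
        (\<Sum>i<m. Re (braket (\<psi>' i) (\<psi>' i)) * schmidt (\<psi>' i) k)" if "k < CARD('n)" for k
    proof -
      have "schmidt (schmidt_state t :: 'n bistate) k = (t k)\<^sup>2"
        using norm_square_mult_schmidt[OF unitary_mat_1 unitary_mat_1 t id that] norm_t by simp
      also have "\<dots> = (\<Sum>i<m. Re (braket (\<psi>' i) (\<psi>' i)) * schmidt (\<psi>' i) k)"
        unfolding t2 braket_self Re_complex_of_real
        by (intro sum.cong refl norm_square_mult_schmidt[OF \<psi>' that, symmetric])
      finally show ?thesis .
    qed
    then have "majorizes CARD('n) (schmidt (schmidt_state t :: 'n bistate)) \<mu>"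
      using maj by (simp add: majorizes_def)
    moreover have "f \<le> cmod (braket (schmidt_state t) (schmidt_state s :: 'n bistate))"
    proof -
      have "f \<le> (\<Sum>i<m. \<Sum>k<CARD('n). a i k * b i k)"
      proof (rule order_trans[OF f], rule sum_mono)
        show "cmod (braket (\<psi> i) (\<psi>' i)) \<le> (\<Sum>k<CARD('n). a i k * b i k)" for i
          unfolding \<psi>(4) \<psi>'(4) by (rule cmod_braket_schmidt_le[OF \<psi>(1,2) \<psi>'(1,2) \<psi>(3) \<psi>'(3)])
      qed
      also have "\<dots> = (\<Sum>k<CARD('n). \<Sum>i<m. a i k * b i k)" by (rule sum.swap)
      also have "\<dots> \<le> (\<Sum>k<CARD('n). s k * t k)"
      proof (rule sum_mono)
        fix k
        \<comment> \<open>Absolute values give the form of Cauchy-Schwarz stated for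
          \<open>L2_set\<close>; here \<open>k\<close> is unrestricted, and beyond
          \<open>CARD('n)\<close> the signs are unknown.\<close>
        have "(\<Sum>i<m. a i k * b i k) \<le> (\<Sum>i<m. \<bar>a i k\<bar> * \<bar>b i k\<bar>)"
          by (intro sum_mono) (simp flip: abs_mult)
        also have "\<dots> \<le> s k * t k"
          unfolding s_def t_def by (rule L2_set_mult_ineq[unfolded L2_set_def])
        finally show "(\<Sum>i<m. a i k * b i k) \<le> s k * t k" .
      qed
      also have "\<dots> = (\<Sum>j\<in>(UNIV :: 'n set). s (idx j) * t (idx j))" by (rule sum_idx[symmetric])
      also have "\<dots> = Re (braket (schmidt_state t) (schmidt_state s :: 'n bistate))"
        by (simp add: braket_schmidt_state) (simp add: schmidt_state_def mult.commute)
      also have "\<dots> \<le> cmod (braket (schmidt_state t) (schmidt_state s :: 'n bistate))"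
        by (rule complex_Re_le_cmod)
      finally show ?thesis .
    qed
    ultimately show ?thesis using norm_s norm_t ketbra_in_S_mu_f_iff by blast
  qed
  ultimately show ?thesis
    using norm_s unfolding S_mu_f_plus_def mem_Collect_eq braket_self_eq_1_iff
    by (intro exI[of _ ?L] exI[of _ "schmidt_state s"] conjI)
qed

theorem theorem3:
  fixes \<mu> :: "nat \<Rightarrow> real" and f :: real and \<rho> :: "'n::finite biop"
  assumes "schmidt_vector CARD('n) \<mu>"
    and "0 \<le> f" and "f \<le> 1"
    and "density_matrix \<rho>"
  shows "\<rho> \<in> S_mu_f_plus \<mu> f \<longleftrightarrow> approximable \<mu> f \<rho>"
  using S_mu_f_plus_imp_approximable approximable_imp_S_mu_f_plus assms(4) by blast

end
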